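(* Let $\mathcal A$ be a $\mathbb Z^n$-graded associative commutative algebra with unit and let $\alpha\in\mathbb Z^n$. The multiplication on $\mathcal D^\alpha(\mathcal A)=\bigoplus_{i\ge0}\mathcal D^\alpha_i(\mathcal A)$ defined inductively by $$(A\cdot B)(a)=(-1)^{\langle a+\alpha,B+j\alpha\rangle+j}A(a)\cdot B+A\cdot B(a),\qquad a\in\mathcal A,\ A\in\mathcal D^\alpha_i(\mathcal A),\ B\in\mathcal D^\alpha_j(\mathcal A),$$ turns the space $\mathcal D^\alpha(\mathcal A)$ of first-order polydifferential operators on $\mathcal A$ into a $\mathbb Z^{n+1}$-graded associative commutative unital algebra, with homogeneous elements $A$ from $\mathcal D^\alpha_i(\mathcal A)$ being of degree $(|A|+i\alpha,i)$ (so $A\cdot B=(-1)^{\langle A+i\alpha,B+j\alpha\rangle+ij}B\cdot A$). The graded subspace $\mathcal{DE}^\alpha(\mathcal A)$ of polyderivations is a graded subalgebra of $\mathcal D^\alpha(\mathcal A)$.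
   Context: Fix a ground field of characteristic $0$; $\langle\cdot,\cdot\rangle$ is the standard pairing on $\mathbb Z^n$ (resp. $\mathbb Z^{n+1}$). $\mathcal A$ is $\mathbb Z^n$-graded, associative, with unit $\mathbf 1$, and graded commutative: $ab=(-1)^{\langle |a|,|b|\rangle}ba$. All elements in formulas are homogeneous and in exponents a symbol denotes its degree ($a$ for $|a|$, $D$ for $|D|$). The graded $\mathcal A$-bimodules $\mathcal D^\alpha_i=\mathcal D^\alpha_i(\mathcal A)$ (of genus $i$) are defined by induction. In each, the right module structure is defined from the left one by $p\cdot a=(-1)^{\langle a,p+i\alpha\rangle}a\cdot p$ for $p\in\mathcal D^\alpha_i$, $a\in\mathcal A$. $\mathcal D^\alpha_0=\mathcal A$. $\mathcal D^\alpha_1$ is the space of graded linear maps $D:\mathcal A\to\mathcal A$ ($|D(a)|=|D|+|a|$) with $D(ab)=D(a)b+(-1)^{\langle a,D\rangle}aD(b)-D(\mathbf 1)ab$. For $i>1$, $\mathcal D^\alpha_i$ consists of graded linear maps $D:\mathcal A\to\mathcal D^\alpha_{i-1}$ such that $$D(ab)=D(a)\cdot b+(-1)^{\langle a,D+(i-1)\alpha\rangle}a\cdot D(b)-D(\mathbf 1)\cdot ab,\qquad D(a,b)=-(-1)^{\langle a+\alpha,b+\alpha\rangle}D(b,a),$$ where $D(a_1,\dots,a_j)=D(a_1,\dots,a_{j-1})(a_j)$. The left module structure is $(a\cdot D)(b)=a\cdot D(b)$. $\mathcal{DE}^\alpha_i\subset\mathcal D^\alpha_i$ consists of those $D$ with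 $D(\mathbf 1)=0$ ($\mathcal{DE}^\alpha_0=\mathcal A$), and $\mathcal{DE}^\alpha(\mathcal A)=\bigoplus_i\mathcal{DE}^\alpha_i$. In the inductive formula for the product one puts $A(a)=0$ for $A\in\mathcal D^\alpha_0=\mathcal A$; products with elements of $\mathcal D_0^\alpha=\mathcal A$ are the left and right module structures; $A\cdot B\in\mathcal D^\alpha_{i+j}$ for $A\in\mathcal D_i^\alpha$, $B\in\mathcal D_j^\alpha$. *)

theory Defs
  imports Complex_Main "HOL-Library.Function_Algebras"
begin

section \<open>Graded commutative algebras\<close>

text \<open>Multidegrees, i.e. elements of \<open>Z^n\<close>, are functions on \<open>nat\<close> that vanish from \<open>n\<close> on;
  they are added pointwise.\<close>

type_synonym deg = "nat \<Rightarrow> int"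

definition Zn :: "nat \<Rightarrow> deg set" where
  "Zn n = {d. \<forall>k\<ge>n. d k = 0}"

definition pairing :: "nat \<Rightarrow> deg \<Rightarrow> deg \<Rightarrow> int" where
  "pairing n d e = (\<Sum>k<n. d k * e k)"

text \<open>\<open>sg k x\<close> is \<open>(-1)^k x\<close>.\<close>

definition sg :: "int \<Rightarrow> 'v::ab_group_add \<Rightarrow> 'v" where
  "sg k x = (if even k then x else - x)"

text \<open>\<open>C\<close> is the internal direct sum of the subspaces \<open>V d\<close>, \<open>d \<in> Zn n\<close>
  (the values of \<open>V\<close> outside \<open>Zn n\<close> are irrelevant).\<close>

locale graded_space = vector_space scale
  for scale :: "'k::field \<Rightarrow> 'v::ab_group_add \<Rightarrow> 'v" +
  fixes n :: nat and C :: "'v set" and V :: "deg \<Rightarrow> 'v set"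
  assumes subspace_carrier: "subspace C"
    and subspace_component: "d \<in> Zn n \<Longrightarrow> subspace (V d)"
    and component_subset: "d \<in> Zn n \<Longrightarrow> V d \<subseteq> C"
    and direct_sum: "x \<in> C \<Longrightarrow>
      \<exists>!f. finite {d. f d \<noteq> 0} \<and> (\<forall>d\<in>Zn n. f d \<in> V d) \<and> (\<forall>d. d \<notin> Zn n \<longrightarrow> f d = 0)
         \<and> x = (\<Sum>d | f d \<noteq> 0. f d)"

locale graded_comm_algebra = graded_space scale n C V
  for scale :: "'k::field \<Rightarrow> 'v::ab_group_add \<Rightarrow> 'v"
    and n :: nat and C :: "'v set" and V :: "deg \<Rightarrow> 'v set" +
  fixes mult :: "'v \<Rightarrow> 'v \<Rightarrow> 'v" and one :: 'v
  assumes mult_closed: "x \<in> C \<Longrightarrow> y \<in> C \<Longrightarrow> mult x y \<in> C"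
    and mult_add_left: "x \<in> C \<Longrightarrow> y \<in> C \<Longrightarrow> z \<in> C \<Longrightarrow> mult (x + y) z = mult x z + mult y z"
    and mult_add_right: "x \<in> C \<Longrightarrow> y \<in> C \<Longrightarrow> z \<in> C \<Longrightarrow> mult x (y + z) = mult x y + mult x z"
    and mult_scale_left: "x \<in> C \<Longrightarrow> y \<in> C \<Longrightarrow> mult (scale c x) y = scale c (mult x y)"
    and mult_scale_right: "x \<in> C \<Longrightarrow> y \<in> C \<Longrightarrow> mult x (scale c y) = scale c (mult x y)"
    and mult_assoc: "x \<in> C \<Longrightarrow> y \<in> C \<Longrightarrow> z \<in> C \<Longrightarrow> mult (mult x y) z = mult x (mult y z)"
    and one_component: "one \<in> V 0"
    and one_left: "x \<in> C \<Longrightarrow> mult one x = x"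
    and one_right: "x \<in> C \<Longrightarrow> mult x one = x"
    and mult_component: "d \<in> Zn n \<Longrightarrow> e \<in> Zn n \<Longrightarrow> a \<in> V d \<Longrightarrow> b \<in> V e \<Longrightarrow> mult a b \<in> V (d + e)"
    and mult_graded_comm: "d \<in> Zn n \<Longrightarrow> e \<in> Zn n \<Longrightarrow> a \<in> V d \<Longrightarrow> b \<in> V e \<Longrightarrow>
      mult a b = sg (pairing n d e) (mult b a)"

locale graded_subalgebra = graded_comm_algebra scale n C V mult one
  for scale :: "'k::field \<Rightarrow> 'v::ab_group_add \<Rightarrow> 'v"
    and n :: nat and C :: "'v set" and V :: "deg \<Rightarrow> 'v set"
    and mult :: "'v \<Rightarrow> 'v \<Rightarrow> 'v" and one :: 'v +
  fixes W :: "'v set"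
  assumes sub_subspace: "subspace W"
    and sub_subset: "W \<subseteq> C"
    and sub_one: "one \<in> W"
    and sub_mult: "x \<in> W \<Longrightarrow> y \<in> W \<Longrightarrow> mult x y \<in> W"
    and sub_graded: "W = span (\<Union>d\<in>Zn n. W \<inter> V d)"


section \<open>Polydifferential operators\<close>

text \<open>An operator \<open>D\<close> of genus \<open>i\<close>, an iterated map with \<open>i\<close> arguments in the algebra, is encoded
  as the function that sends the list \<open>[a\<^sub>1, \<dots>, a\<^sub>i]\<close> to \<open>D(a\<^sub>1, \<dots>, a\<^sub>i)\<close> and every list of another
  length to \<open>0\<close>. Operators of different genus thus live in a single vector space, and
  \<open>ap A a = 0\<close> for \<open>A\<close> of genus \<open>0\<close>.\<close>

type_synonym 'a oper = "'a list \<Rightarrow> 'a"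

definition ap :: "'a oper \<Rightarrow> 'a \<Rightarrow> 'a oper" where
  "ap D a = (\<lambda>xs. D (a # xs))"

definition emb :: "'a::zero \<Rightarrow> 'a oper" where
  "emb a = (\<lambda>xs. if xs = [] then a else 0)"

definition pscale :: "('k \<Rightarrow> 'a \<Rightarrow> 'a) \<Rightarrow> 'k \<Rightarrow> 'a oper \<Rightarrow> 'a oper" where
  "pscale scale c D = (\<lambda>xs. scale c (D xs))"

text \<open>The degree \<open>d + i\<alpha>\<close>.\<close>

definition shift :: "deg \<Rightarrow> nat \<Rightarrow> deg \<Rightarrow> deg" where
  "shift \<alpha> i d = (\<lambda>k. d k + int i * \<alpha> k)"

definition lmul :: "'a::times \<Rightarrow> 'a oper \<Rightarrow> 'a oper" where
  "lmul a D = (\<lambda>xs. a * D xs)"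

text \<open>The right action on \<open>p\<close> of genus \<open>i\<close> and degree \<open>d\<close> of an element \<open>a\<close> of degree \<open>e\<close>.\<close>

definition rmul :: "nat \<Rightarrow> deg \<Rightarrow> nat \<Rightarrow> deg \<Rightarrow> deg \<Rightarrow> 'a::ring oper \<Rightarrow> 'a \<Rightarrow> 'a oper" where
  "rmul n \<alpha> i d e p a = sg (pairing n e (shift \<alpha> i d)) (lmul a p)"

text \<open>\<open>pdo n scale V \<alpha> i d\<close> is the degree \<open>d\<close> component of the space of operators of genus \<open>i\<close>
  on the algebra \<open>'a\<close> with grading \<open>V\<close>. In the clause for genus \<open>Suc i\<close> the values \<open>D(a)\<close> have
  genus \<open>i\<close>.\<close>

primrec pdo :: "nat \<Rightarrow> ('k::field \<Rightarrow> 'a::{ring,monoid_mult} \<Rightarrow> 'a) \<Rightarrow> (deg \<Rightarrow> 'a set) \<Rightarrow> deg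
    \<Rightarrow> nat \<Rightarrow> deg \<Rightarrow> 'a oper set" where
  "pdo n scale V \<alpha> 0 d = emb ` V d"
| "pdo n scale V \<alpha> (Suc i) d = {D. D [] = 0
     \<and> (\<forall>a b. ap D (a + b) = ap D a + ap D b)
     \<and> (\<forall>c a. ap D (scale c a) = pscale scale c (ap D a))
     \<and> (\<forall>e\<in>Zn n. \<forall>a\<in>V e. ap D a \<in> pdo n scale V \<alpha> i (d + e))
     \<and> (\<forall>e\<in>Zn n. \<forall>f\<in>Zn n. \<forall>a\<in>V e. \<forall>b\<in>V f.
          ap D (a * b) = rmul n \<alpha> i (d + e) f (ap D a) b
            + sg (pairing n e (shift \<alpha> i d)) (lmul a (ap D b))
            - rmul n \<alpha> i d (e + f) (ap D 1) (a * b))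
     \<and> (0 < i \<longrightarrow> (\<forall>e\<in>Zn n. \<forall>f\<in>Zn n. \<forall>a\<in>V e. \<forall>b\<in>V f.
          ap (ap D a) b = - sg (pairing n (e + \<alpha>) (f + \<alpha>)) (ap (ap D b) a)))}"

definition genus_space :: "nat \<Rightarrow> ('k::field \<Rightarrow> 'a::{ring,monoid_mult} \<Rightarrow> 'a) \<Rightarrow> (deg \<Rightarrow> 'a set)
    \<Rightarrow> deg \<Rightarrow> nat \<Rightarrow> 'a oper set" where
  "genus_space n scale V \<alpha> i = module.span (pscale scale) (\<Union>d\<in>Zn n. pdo n scale V \<alpha> i d)"

definition polydiff :: "nat \<Rightarrow> ('k::field \<Rightarrow> 'a::{ring,monoid_mult} \<Rightarrow> 'a) \<Rightarrow> (deg \<Rightarrow> 'a set)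
    \<Rightarrow> deg \<Rightarrow> 'a oper set" where
  "polydiff n scale V \<alpha> = module.span (pscale scale) (\<Union>i. genus_space n scale V \<alpha> i)"

definition polyder_genus :: "nat \<Rightarrow> ('k::field \<Rightarrow> 'a::{ring,monoid_mult} \<Rightarrow> 'a) \<Rightarrow> (deg \<Rightarrow> 'a set)
    \<Rightarrow> deg \<Rightarrow> nat \<Rightarrow> 'a oper set" where
  "polyder_genus n scale V \<alpha> i = {D \<in> genus_space n scale V \<alpha> i. 0 < i \<longrightarrow> ap D 1 = 0}"

definition polyder :: "nat \<Rightarrow> ('k::field \<Rightarrow> 'a::{ring,monoid_mult} \<Rightarrow> 'a) \<Rightarrow> (deg \<Rightarrow> 'a set)
    \<Rightarrow> deg \<Rightarrow> 'a oper set" where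
  "polyder n scale V \<alpha> = module.span (pscale scale) (\<Union>i. polyder_genus n scale V \<alpha> i)"

text \<open>The element \<open>(d + i\<alpha>, i)\<close> of \<open>Z^(n+1)\<close>.\<close>

definition total_deg :: "nat \<Rightarrow> deg \<Rightarrow> nat \<Rightarrow> deg \<Rightarrow> deg" where
  "total_deg n \<alpha> i d = (shift \<alpha> i d)(n := int i)"

text \<open>For \<open>\<alpha> \<in> Zn n\<close> at most one pair \<open>(i, d)\<close> contributes to the union; degrees with negative
  last entry carry the zero space.\<close>

definition polydiff_component :: "nat \<Rightarrow> ('k::field \<Rightarrow> 'a::{ring,monoid_mult} \<Rightarrow> 'a)
    \<Rightarrow> (deg \<Rightarrow> 'a set) \<Rightarrow> deg \<Rightarrow> deg \<Rightarrow> 'a oper set" where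
  "polydiff_component n scale V \<alpha> \<delta> =
     insert 0 (\<Union>{pdo n scale V \<alpha> i d | i d. d \<in> Zn n \<and> total_deg n \<alpha> i d = \<delta>})"

text \<open>\<open>m\<close> is, on the space of polydifferential operators, a bilinear operation that is given on
  homogeneous elements by the inductive formula for the product.\<close>

definition polydiff_product :: "nat \<Rightarrow> ('k::field \<Rightarrow> 'a::{ring,monoid_mult} \<Rightarrow> 'a)
    \<Rightarrow> (deg \<Rightarrow> 'a set) \<Rightarrow> deg \<Rightarrow> ('a oper \<Rightarrow> 'a oper \<Rightarrow> 'a oper) \<Rightarrow> bool" where
  "polydiff_product n scale V \<alpha> m \<longleftrightarrow>
     (\<forall>A\<in>polydiff n scale V \<alpha>. \<forall>A'\<in>polydiff n scale V \<alpha>. \<forall>B\<in>polydiff n scale V \<alpha>. \<forall>c.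
        m (A + A') B = m A B + m A' B \<and> m B (A + A') = m B A + m B A'
        \<and> m (pscale scale c A) B = pscale scale c (m A B)
        \<and> m B (pscale scale c A) = pscale scale c (m B A))
   \<and> (\<forall>i j. \<forall>d\<in>Zn n. \<forall>e\<in>Zn n. \<forall>A\<in>pdo n scale V \<alpha> i d. \<forall>B\<in>pdo n scale V \<alpha> j e.
        m A B \<in> pdo n scale V \<alpha> (i + j) (d + e))
   \<and> (\<forall>i. \<forall>d\<in>Zn n. \<forall>e\<in>Zn n. \<forall>A\<in>pdo n scale V \<alpha> i d. \<forall>a\<in>V e.
        m (emb a) A = lmul a A \<and> m A (emb a) = rmul n \<alpha> i d e A a)
   \<and> (\<forall>i j. \<forall>d\<in>Zn n. \<forall>e\<in>Zn n. \<forall>f\<in>Zn n.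
        \<forall>A\<in>pdo n scale V \<alpha> i d. \<forall>B\<in>pdo n scale V \<alpha> j e. \<forall>a\<in>V f.
        ap (m A B) a = sg (pairing n (f + \<alpha>) (shift \<alpha> j e) + int j) (m (ap A a) B)
                       + m A (ap B a))"

end

theory Submission
  imports Defs
begin

text \<open>Give an operator of genus \<open>i\<close> and degree \<open>d\<close> the total degree \<open>(d + i\<alpha>, i)\<close>. The bimodule
  structure is then graded commutativity with elements of total degree \<open>(f, 0)\<close>, and evaluation at
  \<open>a\<close> of degree \<open>f\<close> is a right derivation of the product of parity \<open>(f + \<alpha>, 1)\<close>; the antisymmetry
  condition says that these derivations commute in the graded sense. Since an operator of positive
  genus is determined by its values, closedness, associativity and commutativity all follow by
  induction on the total genus: apply the derivation to both sides and compare signs.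
  To have a product that is bilinear on all functions on lists, one splits an argument into its
  homogeneous components; the sign, which depends on the degree of the second factor, is produced by
  twisting this factor with the automorphisms \<open>x \<mapsto> (-1)\<^bsup>\<langle>\<epsilon>, x\<rangle>\<^esup> x\<close> of the algebra, so
  that no homogeneity of the factors is needed. The grading is direct because its components are
  cut out by additive projections.\<close>

section \<open>Signs and degrees\<close>

lemma sg_zero [simp]: "sg k 0 = 0"
  by (simp add: sg_def)

lemma sg_even [simp]: "even k \<Longrightarrow> sg k x = x"
  by (simp add: sg_def)

lemma sg_sg [simp]: "sg k (sg l x) = sg (k + l) x"
  by (simp add: sg_def)

lemma sg_add: "sg k (x + y) = sg k x + sg k y"
  by (simp add: sg_def)

lemma sg_minus: "- sg k x = sg (k + 1) x"
  by (simp add: sg_def)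

lemma sg_diff: "sg k (x - y) = sg k x - sg k y"
  by (simp add: sg_def)

lemma sg_sum: "sg k (sum f S) = (\<Sum>x\<in>S. sg k (f x))"
  by (simp add: sg_def sum_negf)

lemma sg_cong: "even (k + l) \<Longrightarrow> sg k x = sg l x"
  by (auto simp: sg_def)

lemma sg_apply [simp]: "(sg k D) xs = sg k (D xs)"
  by (simp add: sg_def)

lemma pairing_commute: "pairing n d e = pairing n e d"
  by (simp add: pairing_def mult.commute)

lemma pairing_add_left: "pairing n (d + e) f = pairing n d f + pairing n e f"
  by (simp add: pairing_def sum.distrib algebra_simps)

lemma pairing_add_right: "pairing n f (d + e) = pairing n f d + pairing n f e"
  by (simp add: pairing_def sum.distrib algebra_simps)

lemma pairing_shift_right: "pairing n f (shift \<alpha> i d) = pairing n f d + int i * pairing n f \<alpha>"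
  by (simp add: pairing_def shift_def sum.distrib sum_distrib_left algebra_simps)

lemma pairing_shift_left: "pairing n (shift \<alpha> i d) f = pairing n d f + int i * pairing n \<alpha> f"
  by (simp add: pairing_def shift_def sum.distrib sum_distrib_left algebra_simps)

lemma pairing_zero [simp]: "pairing n 0 d = 0" "pairing n d 0 = 0"
  by (simp_all add: pairing_def)

lemmas pairing_simps = pairing_add_left pairing_add_right pairing_shift_left pairing_shift_right

lemma Zn_zero [simp]: "0 \<in> Zn n"
  by (simp add: Zn_def)

lemma Zn_add [simp]: "d \<in> Zn n \<Longrightarrow> e \<in> Zn n \<Longrightarrow> d + e \<in> Zn n"
  by (simp add: Zn_def)

section \<open>Evaluation, scalar multiplication and embedded elements\<close>

lemma ap_apply: "ap D a xs = D (a # xs)"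
  by (simp add: ap_def)

lemma ap_zero_oper [simp]: "ap 0 a = 0"
  by (simp add: ap_def fun_eq_iff)

lemma ap_add_oper [simp]: "ap (D + E) a = ap D a + ap E a"
  by (simp add: ap_def fun_eq_iff)

lemma ap_pscale_oper [simp]: "ap (pscale s c D) a = pscale s c (ap D a)"
  by (simp add: ap_def fun_eq_iff pscale_def)

lemma ap_sg_oper [simp]: "ap (sg k D) a = sg k (ap D a)"
  by (simp add: ap_def fun_eq_iff)

lemma ap_emb [simp]: "ap (emb b) a = 0"
  by (simp add: ap_def fun_eq_iff emb_def)

lemma ap_lmul [simp]: "ap (lmul b D) a = lmul b (ap D a)"
  by (simp add: ap_def fun_eq_iff lmul_def)

lemma oper_eqI: "D [] = E [] \<Longrightarrow> (\<And>a. ap D a = ap E a) \<Longrightarrow> D = E"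
proof
  fix xs
  assume "D [] = E []" "\<And>a. ap D a = ap E a"
  then show "D xs = E xs"
    by (cases xs) (auto simp: ap_def fun_eq_iff)
qed

lemma mult_sg_right: "a * sg k b = sg k (a * b)" for a b :: "'a::ring"
  by (simp add: sg_def)

lemma mult_sg_left: "sg k a * b = sg k (a * b)" for a b :: "'a::ring"
  by (simp add: sg_def)

lemma lmul_zero [simp]: "lmul a 0 = 0" for a :: "'a::ring"
  by (simp add: lmul_def fun_eq_iff)

lemma lmul_add: "lmul a (D + E) = lmul a D + lmul a E" for a :: "'a::ring"
  by (simp add: lmul_def fun_eq_iff algebra_simps)

lemma lmul_sg: "lmul a (sg k D) = sg k (lmul a D)" for a :: "'a::ring"
  by (simp add: lmul_def fun_eq_iff mult_sg_right)

lemma emb_zero [simp]: "emb 0 = 0"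
  by (simp add: emb_def fun_eq_iff)

section \<open>Direct sums cut out by projections\<close>

text \<open>Applying \<open>P d\<close> to a decomposition returns its coordinate at
  \<open>d\<close>, which gives uniqueness; existence follows by induction on the span. The second
  conclusion identifies coordinates with projections.\<close>

lemma (in vector_space) graded_space_spanI:
  assumes subspace: "\<And>d. d \<in> Zn n \<Longrightarrow> subspace (V d)"
    and add: "\<And>d x y. d \<in> Zn n \<Longrightarrow> P d (x + y) = P d x + P d y"
    and same: "\<And>d x. d \<in> Zn n \<Longrightarrow> x \<in> V d \<Longrightarrow> P d x = x"
    and other: "\<And>d e x. d \<in> Zn n \<Longrightarrow> e \<in> Zn n \<Longrightarrow> d \<noteq> e \<Longrightarrow> x \<in> V e \<Longrightarrow> P d x = 0"
  shows "graded_space scale n (span (\<Union>d\<in>Zn n. V d)) V"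
    and "\<And>f d. finite {d. f d \<noteq> 0} \<Longrightarrow> (\<forall>d\<in>Zn n. f d \<in> V d) \<Longrightarrow> (\<forall>d. d \<notin> Zn n \<longrightarrow> f d = 0) \<Longrightarrow>
      d \<in> Zn n \<Longrightarrow> P d (\<Sum>d | f d \<noteq> 0. f d) = f d"
proof -
  define dec where "dec x f \<longleftrightarrow> finite {d. f d \<noteq> 0} \<and> (\<forall>d\<in>Zn n. f d \<in> V d)
    \<and> (\<forall>d. d \<notin> Zn n \<longrightarrow> f d = 0) \<and> x = (\<Sum>d | f d \<noteq> 0. f d)" for x f
  have P_sum: "P d (sum f S) = (\<Sum>e\<in>S. P d (f e))" if "d \<in> Zn n" for d and f :: "deg \<Rightarrow> 'b" and S
  proof -
    have "P d 0 = 0" using add[OF that, of 0 0] by simp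
    then show ?thesis by (induction S rule: infinite_finite_induct) (simp_all add: add that)
  qed
  show P_dec: "P d (\<Sum>d | f d \<noteq> 0. f d) = f d"
    if "finite {d. f d \<noteq> 0}" "\<forall>d\<in>Zn n. f d \<in> V d" "\<forall>d. d \<notin> Zn n \<longrightarrow> f d = 0" "d \<in> Zn n" for f d
  proof -
    have "P d (\<Sum>d | f d \<noteq> 0. f d) = (\<Sum>e | f e \<noteq> 0. P d (f e))"
      using that by (simp add: P_sum)
    also have "\<dots> = (\<Sum>e | f e \<noteq> 0. if e = d then f d else 0)"
      by (rule sum.cong) (use that in \<open>auto simp: same intro: other\<close>)
    also have "\<dots> = f d"
      using that(1) by simp
    finally show ?thesis .
  qed
  have ex: "\<exists>f. dec x f" if "x \<in> span (\<Union>d\<in>Zn n. V d)" for x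
    using that
  proof (induction rule: span_induct_alt)
    case base
    show ?case
      by (rule exI[of _ "\<lambda>_. 0"]) (use subspace subspace_0 in \<open>auto simp: dec_def\<close>)
  next
    case (step c x y)
    then obtain e f where e: "e \<in> Zn n" "x \<in> V e" and f: "dec y f"
      by auto
    define g where "g = f(e := scale c x + f e)"
    \<comment> \<open>The new coordinate \<open>scale c x + f e\<close> may vanish and
      \<open>f e\<close> may be zero, so both sums are compared over a common superset of the
      supports.\<close>
    let ?S = "insert e {d. f d \<noteq> 0}"
    have fin: "finite ?S" "{d. g d \<noteq> 0} \<subseteq> ?S" "{d. f d \<noteq> 0} \<subseteq> ?S"
      using f by (auto simp: dec_def g_def)
    have "(\<Sum>d | g d \<noteq> 0. g d) = (\<Sum>d\<in>?S. g d)"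
      by (rule sum.mono_neutral_left) (use fin in auto)
    also have "\<dots> = scale c x + f e + (\<Sum>d\<in>?S - {e}. f d)"
      using fin(1) by (subst sum.remove[of _ e]) (auto simp: g_def intro!: sum.cong)
    also have "\<dots> = scale c x + (\<Sum>d\<in>?S. f d)"
      using fin(1) by (subst (2) sum.remove[of _ e]) (auto simp: add.assoc)
    also have "(\<Sum>d\<in>?S. f d) = y"
      using f fin by (auto simp: dec_def intro!: sum.mono_neutral_right)
    finally have "scale c x + y = (\<Sum>d | g d \<noteq> 0. g d)" ..
    moreover have "finite {d. g d \<noteq> 0}"
      using fin finite_subset by blast
    moreover have "\<forall>d\<in>Zn n. g d \<in> V d" "\<forall>d. d \<notin> Zn n \<longrightarrow> g d = 0"
      using e f subspace by (auto simp: g_def dec_def subspace_add subspace_scale)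
    ultimately show ?case
      by (auto simp: dec_def)
  qed
  have unique: "f = g" if "dec x f" "dec x g" for x f g
  proof
    fix d
    show "f d = g d"
      using that P_dec[of f d] P_dec[of g d] by (cases "d \<in> Zn n") (auto simp: dec_def)
  qed
  show "graded_space scale n (span (\<Union>d\<in>Zn n. V d)) V"
  proof
    fix x
    assume "x \<in> span (\<Union>d\<in>Zn n. V d)"
    then have "\<exists>!f. dec x f"
      using ex unique by blast
    then show "\<exists>!f. finite {d. f d \<noteq> 0} \<and> (\<forall>d\<in>Zn n. f d \<in> V d)
        \<and> (\<forall>d. d \<notin> Zn n \<longrightarrow> f d = 0) \<and> x = (\<Sum>d | f d \<noteq> 0. f d)"
      by (simp add: dec_def)
  qed (auto simp: subspace intro: span_base)
qed

section \<open>Homogeneous components\<close>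

locale polydiff_algebra = graded_comm_algebra scale n UNIV V "(*)" 1
  for scale :: "'k::field \<Rightarrow> 'a::{ring,monoid_mult} \<Rightarrow> 'a" and n V +
  fixes \<alpha> :: deg
  assumes \<alpha>: "\<alpha> \<in> Zn n"
begin

abbreviation "pr \<equiv> pairing n"
abbreviation "PD \<equiv> pdo n scale V \<alpha>"

sublocale ops: vector_space "pscale scale"
  by unfold_locales (auto simp: pscale_def fun_eq_iff scale_right_distrib scale_left_distrib)

lemma sg_scale: "scale c (sg k x) = sg k (scale c x)"
  by (simp add: sg_def)

lemma pscale_sg: "pscale scale c (sg k D) = sg k (pscale scale c D)"
  by (simp add: pscale_def fun_eq_iff sg_scale)

lemma lmul_pscale: "lmul a (pscale scale c D) = pscale scale c (lmul a D)"
  using mult_scale_right by (simp add: lmul_def pscale_def fun_eq_iff)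

lemma V_zero: "d \<in> Zn n \<Longrightarrow> 0 \<in> V d"
  using subspace_component subspace_0 by blast

lemma V_add: "d \<in> Zn n \<Longrightarrow> x \<in> V d \<Longrightarrow> y \<in> V d \<Longrightarrow> x + y \<in> V d"
  using subspace_component subspace_add by blast

lemma V_scale: "d \<in> Zn n \<Longrightarrow> x \<in> V d \<Longrightarrow> scale c x \<in> V d"
  using subspace_component subspace_scale by blast

definition comp :: "'a \<Rightarrow> deg \<Rightarrow> 'a" where
  "comp x = (THE f. finite {d. f d \<noteq> 0} \<and> (\<forall>d\<in>Zn n. f d \<in> V d)
    \<and> (\<forall>d. d \<notin> Zn n \<longrightarrow> f d = 0) \<and> x = (\<Sum>d | f d \<noteq> 0. f d))"

lemma comp_props:
  shows comp_finite: "finite {d. comp x d \<noteq> 0}"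
    and comp_in: "d \<in> Zn n \<Longrightarrow> comp x d \<in> V d"
    and comp_outside: "d \<notin> Zn n \<Longrightarrow> comp x d = 0"
    and comp_sum: "(\<Sum>d | comp x d \<noteq> 0. comp x d) = x"
  using theI'[OF direct_sum[of x], folded comp_def] by auto

text \<open>\<open>S\<close> only has to contain the support, because components may cancel in a sum
  or vanish under a scalar.\<close>

lemma comp_unique:
  assumes "finite S" "\<And>d. d \<notin> S \<Longrightarrow> f d = 0" "\<And>d. d \<in> Zn n \<Longrightarrow> f d \<in> V d"
    "\<And>d. d \<notin> Zn n \<Longrightarrow> f d = 0" "x = (\<Sum>d\<in>S. f d)"
  shows "comp x = f"
proof -
  have sub: "{d. f d \<noteq> 0} \<subseteq> S"
    using assms(2) by auto
  then have "x = (\<Sum>d | f d \<noteq> 0. f d)"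
    unfolding assms(5) using assms(1) by (intro sum.mono_neutral_right) auto
  then show ?thesis
    unfolding comp_def using direct_sum[of x] assms finite_subset[OF sub]
    by (intro the1_equality) auto
qed

lemma sum_comp_superset:
  assumes "finite S" "{d. comp x d \<noteq> 0} \<subseteq> S" "\<And>d. F d 0 = 0"
  shows "(\<Sum>d | comp x d \<noteq> 0. F d (comp x d)) = (\<Sum>d\<in>S. F d (comp x d))"
  using assms by (intro sum.mono_neutral_left) auto

lemma comp_add: "comp (x + y) = (\<lambda>d. comp x d + comp y d)"
proof (rule comp_unique)
  let ?S = "{d. comp x d \<noteq> 0} \<union> {d. comp y d \<noteq> 0}"
  show "finite ?S"
    by (simp add: comp_finite)
  then show "x + y = (\<Sum>d\<in>?S. comp x d + comp y d)"
    using sum_comp_superset[of ?S x "\<lambda>d z. z"] sum_comp_superset[of ?S y "\<lambda>d z. z"]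
    by (simp add: sum.distrib comp_sum)
qed (auto simp: comp_in comp_outside V_add)

lemma comp_scale: "comp (scale c x) = (\<lambda>d. scale c (comp x d))"
  by (rule comp_unique[of "{d. comp x d \<noteq> 0}"])
    (auto simp: comp_finite comp_in comp_outside V_scale comp_sum simp flip: scale_sum_right)

lemma comp_homogeneous: "d \<in> Zn n \<Longrightarrow> x \<in> V d \<Longrightarrow> comp x = (\<lambda>e. if e = d then x else 0)"
  by (rule comp_unique[of "{d}"]) (auto simp: V_zero)

lemma comp_zero: "comp 0 = (\<lambda>_. 0)"
  using comp_homogeneous[of 0 0] V_zero[of 0] by (simp add: fun_eq_iff)

text \<open>Every element is the finite sum of its components. This reduces identities that are
  additive in one argument to homogeneous arguments.\<close>

lemma homogeneous_induct:
  assumes hom: "\<And>d a. d \<in> Zn n \<Longrightarrow> a \<in> V d \<Longrightarrow> P a"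
    and add: "\<And>a b. P a \<Longrightarrow> P b \<Longrightarrow> P (a + b)"
  shows "P x"
proof -
  have "P (\<Sum>d\<in>S. comp x d)" for S
  proof -
    have zero: "P 0"
      using hom[of 0 0] V_zero[of 0] by simp
    have "P (comp x d)" for d
      by (cases "d \<in> Zn n") (auto intro: hom comp_in simp: comp_outside zero)
    then show ?thesis
      by (induction S rule: infinite_finite_induct) (simp_all add: zero add)
  qed
  then show ?thesis
    using comp_sum by metis
qed

text \<open>Extends a rule that depends on the degree to inhomogeneous elements: if each
  \<open>F d\<close> is additive, this is the additive map that agrees with \<open>F d\<close> on
  \<open>V d\<close> for \<open>d\<close> in \<open>Zn n\<close>.\<close>

definition gsum :: "(deg \<Rightarrow> 'a \<Rightarrow> 'b::ab_group_add) \<Rightarrow> 'a \<Rightarrow> 'b" where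
  "gsum F x = (\<Sum>d | comp x d \<noteq> 0. F d (comp x d))"

lemma gsum_homogeneous: "d \<in> Zn n \<Longrightarrow> x \<in> V d \<Longrightarrow> F d 0 = 0 \<Longrightarrow> gsum F x = F d x"
  by (cases "x = 0") (auto simp: gsum_def comp_homogeneous comp_zero)

lemma gsum_add:
  assumes "\<And>d x y. F d (x + y) = F d x + F d y"
  shows "gsum F (x + y) = gsum F x + gsum F y"
proof -
  let ?S = "{d. comp x d \<noteq> 0} \<union> {d. comp y d \<noteq> 0}"
  have zero: "F d 0 = 0" for d
    using assms[of d 0 0] by simp
  have "finite ?S"
    by (simp add: comp_finite)
  then have "gsum F x = (\<Sum>d\<in>?S. F d (comp x d))" "gsum F y = (\<Sum>d\<in>?S. F d (comp y d))"
    "gsum F (x + y) = (\<Sum>d\<in>?S. F d (comp (x + y) d))"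
    unfolding gsum_def by (intro sum_comp_superset; auto simp: zero comp_add)+
  then show ?thesis
    by (simp add: comp_add assms sum.distrib)
qed

lemma gsum_cong:
  assumes "\<And>d x. d \<in> Zn n \<Longrightarrow> x \<in> V d \<Longrightarrow> F d x = G d x"
  shows "gsum F x = gsum G x"
  unfolding gsum_def
proof (rule sum.cong)
  fix d
  assume "d \<in> {d. comp x d \<noteq> 0}"
  then have "d \<in> Zn n"
    using comp_outside by auto
  then show "F d (comp x d) = G d (comp x d)"
    using assms comp_in by blast
qed simp

lemma gsum_plus: "gsum (\<lambda>d x. F d x + G d x) x = gsum F x + gsum G x"
  by (simp add: gsum_def sum.distrib)

lemma gsum_scale:
  assumes "\<And>d x. F d (scale c x) = scale c (F d x)"
  shows "gsum F (scale c x) = scale c (gsum F x)"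
  \<comment> \<open>A nonzero scalar leaves the support of \<open>comp x\<close> unchanged; for
    \<open>c = 0\<close> both sides vanish.\<close>
  by (cases "c = 0") (simp_all add: gsum_def comp_scale comp_zero assms scale_sum_right)

lemma scale_gsum: "scale c (gsum F x) = gsum (\<lambda>d x. scale c (F d x)) x"
  by (simp add: gsum_def scale_sum_right)

lemma mult_gsum: "a * gsum F x = gsum (\<lambda>d x. a * F d x) x" for F :: "deg \<Rightarrow> 'a \<Rightarrow> 'a"
  by (simp add: gsum_def sum_distrib_left)

lemma sg_gsum: "sg k (gsum F x) = gsum (\<lambda>d x. sg k (F d x)) x"
  by (simp add: gsum_def sg_sum)

section \<open>Sign automorphisms of the algebra\<close>

definition psi :: "deg \<Rightarrow> 'a \<Rightarrow> 'a" where
  "psi \<epsilon> = gsum (\<lambda>d x. sg (pr \<epsilon> d) x)"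

lemma psi_add: "psi \<epsilon> (x + y) = psi \<epsilon> x + psi \<epsilon> y"
  unfolding psi_def by (rule gsum_add) (rule sg_add)

lemma psi_scale: "psi \<epsilon> (scale c x) = scale c (psi \<epsilon> x)"
  unfolding psi_def by (rule gsum_scale) (simp add: sg_scale)

lemma psi_homogeneous: "d \<in> Zn n \<Longrightarrow> x \<in> V d \<Longrightarrow> psi \<epsilon> x = sg (pr \<epsilon> d) x"
  unfolding psi_def by (simp add: gsum_homogeneous)

lemma psi_zero [simp]: "psi \<epsilon> 0 = 0"
  using psi_add[of \<epsilon> 0 0] by simp

lemma psi_mult_left:
  assumes "d \<in> Zn n" "b \<in> V d"
  shows "psi \<epsilon> (b * x) = sg (pr \<epsilon> d) (b * psi \<epsilon> x)"
proof (induction x rule: homogeneous_induct)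
  case (1 e a)
  then have "b * a \<in> V (d + e)"
    using assms mult_component by blast
  then show ?case
    using 1 assms psi_homogeneous[of "d + e" "b * a" \<epsilon>]
    by (simp add: psi_homogeneous mult_sg_right pairing_add_right)
next
  case (2 a b)
  then show ?case
    by (simp add: distrib_left psi_add sg_add)
qed

section \<open>Homogeneous operators\<close>

text \<open>Writes the right action and the minus sign of antisymmetry through \<open>sg\<close>, so
  that sign computations become computations with exponents.\<close>

lemma PD_Suc_iff:
  "D \<in> PD (Suc i) d \<longleftrightarrow> D [] = 0
     \<and> (\<forall>a b. ap D (a + b) = ap D a + ap D b)
     \<and> (\<forall>c a. ap D (scale c a) = pscale scale c (ap D a))
     \<and> (\<forall>e\<in>Zn n. \<forall>a\<in>V e. ap D a \<in> PD i (d + e))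
     \<and> (\<forall>e\<in>Zn n. \<forall>f\<in>Zn n. \<forall>a\<in>V e. \<forall>b\<in>V f.
          ap D (a * b) = sg (pr f (shift \<alpha> i (d + e))) (lmul b (ap D a))
            + sg (pr e (shift \<alpha> i d)) (lmul a (ap D b))
            - sg (pr (e + f) (shift \<alpha> i d)) (lmul (a * b) (ap D 1)))
     \<and> (0 < i \<longrightarrow> (\<forall>e\<in>Zn n. \<forall>f\<in>Zn n. \<forall>a\<in>V e. \<forall>b\<in>V f.
          ap (ap D a) b = sg (pr (e + \<alpha>) (f + \<alpha>) + 1) (ap (ap D b) a)))"
  by (subst pdo.simps) (unfold mem_Collect_eq rmul_def sg_minus, rule refl)

lemma PD_SucD:
  assumes "D \<in> PD (Suc i) d"
  shows PD_Suc_Nil: "D [] = 0"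
    and PD_Suc_add: "ap D (a + b) = ap D a + ap D b"
    and PD_Suc_scale: "ap D (scale c a) = pscale scale c (ap D a)"
    and PD_Suc_ap: "e \<in> Zn n \<Longrightarrow> a \<in> V e \<Longrightarrow> ap D a \<in> PD i (d + e)"
    and PD_Suc_leibniz: "e \<in> Zn n \<Longrightarrow> f \<in> Zn n \<Longrightarrow> a \<in> V e \<Longrightarrow> b \<in> V f \<Longrightarrow>
          ap D (a * b) = sg (pr f (shift \<alpha> i (d + e))) (lmul b (ap D a))
            + sg (pr e (shift \<alpha> i d)) (lmul a (ap D b))
            - sg (pr (e + f) (shift \<alpha> i d)) (lmul (a * b) (ap D 1))"
    and PD_Suc_antisym: "0 < i \<Longrightarrow> e \<in> Zn n \<Longrightarrow> f \<in> Zn n \<Longrightarrow> a \<in> V e \<Longrightarrow> b \<in> V f \<Longrightarrow>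
          ap (ap D a) b = sg (pr (e + \<alpha>) (f + \<alpha>) + 1) (ap (ap D b) a)"
proof -
  note * = assms[unfolded PD_Suc_iff]
  note * = *[THEN conjunct1] *[THEN conjunct2, THEN conjunct1]
    *[THEN conjunct2, THEN conjunct2, THEN conjunct1]
    *[THEN conjunct2, THEN conjunct2, THEN conjunct2, THEN conjunct1]
    *[THEN conjunct2, THEN conjunct2, THEN conjunct2, THEN conjunct2, THEN conjunct1]
    *[THEN conjunct2, THEN conjunct2, THEN conjunct2, THEN conjunct2, THEN conjunct2]
  show "D [] = 0" "ap D (a + b) = ap D a + ap D b" "ap D (scale c a) = pscale scale c (ap D a)"
    using *(1-3) by blast+
  show "e \<in> Zn n \<Longrightarrow> a \<in> V e \<Longrightarrow> ap D a \<in> PD i (d + e)"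
    using *(4) by blast
  show "e \<in> Zn n \<Longrightarrow> f \<in> Zn n \<Longrightarrow> a \<in> V e \<Longrightarrow> b \<in> V f \<Longrightarrow>
          ap D (a * b) = sg (pr f (shift \<alpha> i (d + e))) (lmul b (ap D a))
            + sg (pr e (shift \<alpha> i d)) (lmul a (ap D b))
            - sg (pr (e + f) (shift \<alpha> i d)) (lmul (a * b) (ap D 1))"
    using *(5) by blast
  show "0 < i \<Longrightarrow> e \<in> Zn n \<Longrightarrow> f \<in> Zn n \<Longrightarrow> a \<in> V e \<Longrightarrow> b \<in> V f \<Longrightarrow>
          ap (ap D a) b = sg (pr (e + \<alpha>) (f + \<alpha>) + 1) (ap (ap D b) a)"
    using *(6) by blast
qed

text \<open>Degrees and operators are themselves functions, so the simp rules \<open>plus_fun_apply\<close> and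
  \<open>zero_fun_apply\<close> would turn \<open>d + e\<close> and \<open>0\<close> into abstractions; hence they are often removed.\<close>

lemma PD_zero: "d \<in> Zn n \<Longrightarrow> 0 \<in> PD i d"
proof (induction i arbitrary: d)
  case 0
  then show ?case
    using V_zero by (metis emb_zero imageI pdo.simps(1))
next
  case (Suc i)
  moreover have "(0 :: 'a oper) [] = 0"
    by simp
  ultimately show ?case
    by (simp add: PD_Suc_iff del: pdo.simps zero_fun_apply plus_fun_apply)
qed

lemma PD_add: "d \<in> Zn n \<Longrightarrow> D \<in> PD i d \<Longrightarrow> E \<in> PD i d \<Longrightarrow> D + E \<in> PD i d"
proof (induction i arbitrary: D E d)
  case 0
  then obtain x y where "x \<in> V d" "y \<in> V d" "D = emb x" "E = emb y"
    by auto
  moreover have "emb x + emb y = emb (x + y)" for x y :: 'a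
    by (simp add: emb_def fun_eq_iff)
  ultimately show ?case
    using 0 V_add by auto
next
  case (Suc i)
  note D = Suc.prems(2) and E = Suc.prems(3)
  show ?case
    unfolding PD_Suc_iff
  proof (intro conjI allI ballI impI)
    show "(D + E) [] = 0"
      using PD_Suc_Nil[OF D] PD_Suc_Nil[OF E] by simp
    show "ap (D + E) (a + b) = ap (D + E) a + ap (D + E) b" for a b
      by (simp add: PD_Suc_add[OF D] PD_Suc_add[OF E] del: plus_fun_apply)
    show "ap (D + E) (scale c a) = pscale scale c (ap (D + E) a)" for c a
      by (simp add: PD_Suc_scale[OF D] PD_Suc_scale[OF E] ops.scale_right_distrib del: plus_fun_apply)
    show "ap (D + E) a \<in> PD i (d + e)" if "e \<in> Zn n" "a \<in> V e" for e a
      unfolding ap_add_oper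
      by (intro Suc.IH Zn_add Suc.prems(1) that PD_Suc_ap[OF D] PD_Suc_ap[OF E])
  next
    fix e f a b
    assume ef: "e \<in> Zn n" "f \<in> Zn n" "a \<in> V e" "b \<in> V f"
    \<comment> \<open>The right side of the Leibniz rule as a function of the operator alone; what
      has to be shown is its additivity.\<close>
    let ?rhs = "\<lambda>D. sg (pr f (shift \<alpha> i (d + e))) (lmul b (ap D a))
            + sg (pr e (shift \<alpha> i d)) (lmul a (ap D b))
            - sg (pr (e + f) (shift \<alpha> i d)) (lmul (a * b) (ap D 1))"
    have "ap D (a * b) = ?rhs D" "ap E (a * b) = ?rhs E"
      by (fact PD_Suc_leibniz[OF D ef] PD_Suc_leibniz[OF E ef])+
    then show "ap (D + E) (a * b) = ?rhs (D + E)"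
      by (simp add: lmul_add sg_add del: plus_fun_apply)
    assume "0 < i"
    have "ap (ap D a) b = sg (pr (e + \<alpha>) (f + \<alpha>) + 1) (ap (ap D b) a)"
      "ap (ap E a) b = sg (pr (e + \<alpha>) (f + \<alpha>) + 1) (ap (ap E b) a)"
      by (fact PD_Suc_antisym[OF D \<open>0 < i\<close> ef] PD_Suc_antisym[OF E \<open>0 < i\<close> ef])+
    then show "ap (ap (D + E) a) b = sg (pr (e + \<alpha>) (f + \<alpha>) + 1) (ap (ap (D + E) b) a)"
      unfolding ap_add_oper sg_add by simp
  qed
qed

lemma PD_pscale: "d \<in> Zn n \<Longrightarrow> D \<in> PD i d \<Longrightarrow> pscale scale c D \<in> PD i d"
proof (induction i arbitrary: D d)
  case 0
  then obtain x where "x \<in> V d" "D = emb x"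
    by auto
  moreover have "pscale scale c (emb x) = emb (scale c x)" for x
    by (simp add: emb_def pscale_def fun_eq_iff)
  ultimately show ?case
    using 0 V_scale by auto
next
  case (Suc i)
  note D = Suc.prems(2)
  show ?case
    unfolding PD_Suc_iff
  proof (intro conjI allI ballI impI)
    show "pscale scale c D [] = 0"
      using PD_Suc_Nil[OF D] by (simp add: pscale_def)
    show "ap (pscale scale c D) (a + b) = ap (pscale scale c D) a + ap (pscale scale c D) b" for a b
      by (simp add: PD_Suc_add[OF D] ops.scale_right_distrib del: plus_fun_apply)
    show "ap (pscale scale c D) (scale c' a) = pscale scale c' (ap (pscale scale c D) a)" for c' a
      by (simp add: PD_Suc_scale[OF D] mult.commute)
    show "ap (pscale scale c D) a \<in> PD i (d + e)" if "e \<in> Zn n" "a \<in> V e" for e a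
      unfolding ap_pscale_oper
      by (intro Suc.IH Zn_add Suc.prems(1) that PD_Suc_ap[OF D])
  next
    fix e f a b
    assume ef: "e \<in> Zn n" "f \<in> Zn n" "a \<in> V e" "b \<in> V f"
    let ?rhs = "\<lambda>D. sg (pr f (shift \<alpha> i (d + e))) (lmul b (ap D a))
            + sg (pr e (shift \<alpha> i d)) (lmul a (ap D b))
            - sg (pr (e + f) (shift \<alpha> i d)) (lmul (a * b) (ap D 1))"
    have "ap D (a * b) = ?rhs D"
      using ef by (rule PD_Suc_leibniz[OF D])
    then show "ap (pscale scale c D) (a * b) = ?rhs (pscale scale c D)"
      by (simp add: lmul_pscale pscale_sg ops.scale_right_distrib ops.scale_right_diff_distrib
          del: plus_fun_apply)
    assume "0 < i"
    then have "ap (ap D a) b = sg (pr (e + \<alpha>) (f + \<alpha>) + 1) (ap (ap D b) a)"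
      using ef by (rule PD_Suc_antisym[OF D])
    then show "ap (ap (pscale scale c D) a) b
        = sg (pr (e + \<alpha>) (f + \<alpha>) + 1) (ap (ap (pscale scale c D) b) a)"
      unfolding ap_pscale_oper pscale_sg[symmetric] by simp
  qed
qed

lemma PD_sg: "d \<in> Zn n \<Longrightarrow> D \<in> PD i d \<Longrightarrow> sg k D \<in> PD i d"
  using PD_pscale[of d D i "- 1"] by (simp add: sg_def)

declare pdo.simps(2) [simp del]

section \<open>Rules that hold uniformly in all genera\<close>

lemma PD_ap_add: "D \<in> PD i d \<Longrightarrow> ap D (a + b) = ap D a + ap D b"
  by (cases i) (auto simp: PD_Suc_add)

lemma PD_ap_uminus: "D \<in> PD i d \<Longrightarrow> ap D (- a) = - ap D a"
  using PD_ap_add[of D i d a "- a"] PD_ap_add[of D i d 0 0]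
  by (simp add: eq_neg_iff_add_eq_0 add.commute)

lemma PD_ap_scale: "D \<in> PD i d \<Longrightarrow> ap D (scale c a) = pscale scale c (ap D a)"
  by (cases i) (auto simp: PD_Suc_scale)

lemma PD_ap_zero: "D \<in> PD i d \<Longrightarrow> ap D 0 = 0"
  using PD_ap_add[of D i d 0 0] by simp

text \<open>The truncated \<open>i - 1\<close> is harmless: in genus 0 the value is zero, and zero
  lies in every component.\<close>

lemma PD_ap: "D \<in> PD i d \<Longrightarrow> d \<in> Zn n \<Longrightarrow> e \<in> Zn n \<Longrightarrow> a \<in> V e \<Longrightarrow> ap D a \<in> PD (i - 1) (d + e)"
proof (cases i)
  case 0
  assume *: "D \<in> PD i d" "d \<in> Zn n" "e \<in> Zn n"
  then have "ap D a = 0"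
    using 0 by auto
  then show ?thesis
    using PD_zero[OF Zn_add[OF *(2,3)], of "i - 1"] by (simp only:)
qed (simp add: PD_Suc_ap del: plus_fun_apply)

text \<open>For parity the genus \<open>i - 1\<close> of the values may be taken as \<open>i + 1\<close>, which avoids
  truncated subtraction and covers genus 0, where all terms vanish.\<close>

lemma PD_leibniz:
  assumes "D \<in> PD i d" "e \<in> Zn n" "f \<in> Zn n" "a \<in> V e" "b \<in> V f"
  shows "ap D (a * b) = sg (pr f (shift \<alpha> (i + 1) (d + e))) (lmul b (ap D a))
    + sg (pr e (shift \<alpha> (i + 1) d)) (lmul a (ap D b))
    - sg (pr (e + f) (shift \<alpha> (i + 1) d)) (lmul (a * b) (ap D 1))"
proof (cases i)
  case (Suc i')
  have "sg (pr g (shift \<alpha> (i + 1) d')) X = sg (pr g (shift \<alpha> i' d')) X" for g d' and X :: "'a oper"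
    by (rule sg_cong) (simp add: Suc pairing_simps algebra_simps)
  then show ?thesis
    using PD_Suc_leibniz[OF _ assms(2-5)] assms(1) by (simp add: Suc)
qed (use assms in auto)

text \<open>In genus at most 1 two successive evaluations give zero, so both sides vanish and the
  rule extends to every genus.\<close>

lemma PD_antisym:
  assumes "D \<in> PD i d" "e \<in> Zn n" "f \<in> Zn n" "a \<in> V e" "b \<in> V f"
  shows "ap (ap D a) b = sg (pr (e + \<alpha>) (f + \<alpha>) + 1) (ap (ap D b) a)"
proof (cases i)
  case i: (Suc i')
  show ?thesis
  proof (cases i')
    case 0
    then have "ap D a \<in> PD 0 (d + e)" "ap D b \<in> PD 0 (d + f)"
      using assms PD_Suc_ap by (simp_all add: i del: pdo.simps)
    then show ?thesis
      by auto
  next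
    case (Suc i'')
    then show ?thesis
      using PD_Suc_antisym[OF assms(1)[unfolded i] _ assms(2-5)] by blast
  qed
qed (use assms in auto)

lemma PD_Nil: "D \<in> PD i d \<Longrightarrow> 0 < i \<Longrightarrow> D [] = 0"
  by (cases i) (simp_all add: PD_Suc_Nil)

text \<open>Each evaluation lowers the genus by one, and an embedded element lives on the empty
  list. This lets the length of the argument list stand for the genus in \<open>tw\<close> and
  \<open>proj\<close>.\<close>

lemma PD_length: "D \<in> PD i d \<Longrightarrow> d \<in> Zn n \<Longrightarrow> length xs \<noteq> i \<Longrightarrow> D xs = 0"
proof (induction xs arbitrary: D i d)
  case Nil
  then show ?case
    by (simp add: PD_Nil)
next
  case (Cons a xs)
  show ?case
  proof (cases i)
    case 0
    then show ?thesis
      using Cons.prems by (auto simp: emb_def)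
  next
    case (Suc i')
    have "ap D a xs = 0"
    proof (induction a rule: homogeneous_induct)
      case (1 e a)
      then show ?case
        using Cons.IH[OF PD_ap[OF Cons.prems(1,2) 1] Zn_add[OF Cons.prems(2) 1(1)]] Cons.prems Suc by simp
    next
      case (2 a b)
      then show ?case
        by (simp add: PD_ap_add[OF Cons.prems(1)])
    qed
    then show ?thesis
      by (simp add: ap_apply)
  qed
qed

lemma oper_homogeneous_eqI:
  assumes "D [] = E []" "\<And>a b. ap D (a + b) = ap D a + ap D b" "\<And>a b. ap E (a + b) = ap E a + ap E b"
    and "\<And>e a. e \<in> Zn n \<Longrightarrow> a \<in> V e \<Longrightarrow> ap D a = ap E a"
  shows "D = E"
proof (rule oper_eqI)
  show "ap D a = ap E a" for a
    by (induction a rule: homogeneous_induct) (simp_all add: assms)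
qed (rule assms)

section \<open>The product\<close>

text \<open>On operators of degree \<open>e\<close> and genus \<open>j\<close> this is the sign \<open>(-1)^(\<langle>f + \<alpha>, e + j\<alpha>\<rangle> + j)\<close> of the
  product formula: conjugation by \<open>psi (f + \<alpha>)\<close> gives \<open>\<langle>f + \<alpha>, e\<rangle>\<close>, and the number of arguments is \<open>j\<close>.\<close>

definition tw :: "deg \<Rightarrow> 'a oper \<Rightarrow> 'a oper" where
  "tw f B = (\<lambda>xs. sg (int (length xs) * (pr (f + \<alpha>) \<alpha> + 1))
     (psi (f + \<alpha>) (B (map (psi (f + \<alpha>)) xs))))"

lemma tw_add: "tw f (A + B) = tw f A + tw f B"
  by (simp add: tw_def fun_eq_iff psi_add sg_add)

lemma tw_pscale: "tw f (pscale scale c B) = pscale scale c (tw f B)"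
  by (simp add: tw_def fun_eq_iff psi_scale pscale_def sg_scale)

lemma tw_lmul: "g \<in> Zn n \<Longrightarrow> b \<in> V g \<Longrightarrow> tw f (lmul b B) = sg (pr (f + \<alpha>) g) (lmul b (tw f B))"
  by (simp add: tw_def fun_eq_iff lmul_def psi_mult_left mult_sg_right add.commute)

text \<open>The degree of each argument enters the sign twice, once from twisting the argument and
  once through the degree of the value. These contributions cancel and only the degree
  \<open>e\<close> of the operator remains.\<close>

lemma psi_PD:
  "B \<in> PD j e \<Longrightarrow> e \<in> Zn n \<Longrightarrow> psi \<epsilon> (B (map (psi \<epsilon>) xs)) = sg (pr \<epsilon> e) (B xs)"
proof (induction xs arbitrary: B j e)
  case Nil
  then show ?case
    by (cases j) (auto simp: PD_Suc_Nil psi_homogeneous emb_def)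
next
  case (Cons a xs)
  have "psi \<epsilon> (ap B (psi \<epsilon> a) (map (psi \<epsilon>) xs)) = sg (pr \<epsilon> e) (ap B a xs)"
  proof (induction a rule: homogeneous_induct)
    case (1 f a)
    have *: "psi \<epsilon> (ap B a (map (psi \<epsilon>) xs)) = sg (pr \<epsilon> (e + f)) (ap B a xs)"
      by (rule Cons.IH[OF PD_ap[OF Cons.prems 1] Zn_add[OF Cons.prems(2) 1(1)]])
    have "psi \<epsilon> (- x) = - psi \<epsilon> x" for x
      using psi_scale[of \<epsilon> "- 1" x] by simp
    then show ?case
      using * 1 PD_ap_uminus[OF Cons.prems(1), of a]
      by (simp add: psi_homogeneous sg_def pairing_add_right)
  next
    case (2 a b)
    then show ?case
      by (simp add: PD_ap_add[OF Cons.prems(1)] psi_add sg_add)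
  qed
  then show ?case
    by (simp add: ap_apply)
qed

lemma tw_PD:
  assumes "B \<in> PD j e" "e \<in> Zn n"
  shows "tw f B = sg (pr (f + \<alpha>) (shift \<alpha> j e) + int j) B"
proof
  fix xs
  show "tw f B xs = sg (pr (f + \<alpha>) (shift \<alpha> j e) + int j) B xs"
    \<comment> \<open>On lists of length other than \<open>j\<close> both sides vanish; on the
      others the length equals the genus.\<close>
    using PD_length[OF assms, of xs]
    by (cases "length xs = j")
      (auto simp: tw_def psi_PD[OF assms] pairing_shift_right algebra_simps)
qed

text \<open>The product formula as a structural recursion on the argument list instead of the genus.
  \<open>gsum\<close> supplies the degree \<open>f\<close> of the first argument, and
  \<open>tw f\<close> supplies the sign without reference to the degree or genus of
  \<open>B\<close>.\<close>

primrec prd :: "'a list \<Rightarrow> 'a oper \<Rightarrow> 'a oper \<Rightarrow> 'a" where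
  "prd [] A B = A [] * B []"
| "prd (a # xs) A B = gsum (\<lambda>f x. prd xs (ap A x) (tw f B)) a + prd xs A (ap B a)"

definition prod_op :: "'a oper \<Rightarrow> 'a oper \<Rightarrow> 'a oper"  (infixl "\<odot>" 70) where
  "A \<odot> B = (\<lambda>xs. prd xs A B)"

section \<open>Bilinearity and evaluation of the product\<close>

lemma prd_add:
  shows "prd xs (A + A') B = prd xs A B + prd xs A' B"
    and "prd xs A (B + B') = prd xs A B + prd xs A B'"
  by (induction xs arbitrary: A A' B B') (simp_all add: algebra_simps gsum_plus tw_add)

lemma prd_scale:
  shows "prd xs (pscale scale c A) B = scale c (prd xs A B)"
    and "prd xs A (pscale scale c B) = scale c (prd xs A B)"
  using mult_scale_left mult_scale_right
  by (induction xs arbitrary: A B)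
    (simp_all add: scale_right_distrib scale_gsum tw_pscale, simp_all add: pscale_def)

lemma prod_add_left: "(A + A') \<odot> B = A \<odot> B + A' \<odot> B"
  and prod_add_right: "A \<odot> (B + B') = A \<odot> B + A \<odot> B'"
  by (simp_all add: prod_op_def fun_eq_iff prd_add)

lemma prod_scale_left: "pscale scale c A \<odot> B = pscale scale c (A \<odot> B)"
  and prod_scale_right: "A \<odot> pscale scale c B = pscale scale c (A \<odot> B)"
  by (simp_all add: prod_op_def fun_eq_iff prd_scale) (simp_all add: pscale_def)

lemma prod_zero [simp]: "0 \<odot> B = 0" "A \<odot> 0 = 0"
  using prod_add_left[of 0 0 B] prod_add_right[of A 0 0] by simp_all

lemma pscale_minus_one: "pscale scale (- 1) A = - A"
  by (simp add: pscale_def fun_eq_iff)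

lemma prod_sg_left: "sg k A \<odot> B = sg k (A \<odot> B)"
  and prod_sg_right: "A \<odot> sg k B = sg k (A \<odot> B)"
  using prod_scale_left[of "- 1" A B] prod_scale_right[of A "- 1" B]
  by (simp_all add: sg_def pscale_minus_one)

lemma prod_diff_left: "(A - A') \<odot> B = A \<odot> B - A' \<odot> B"
  using prod_add_left[of "A - A'" A' B] by (simp add: algebra_simps)

lemma prod_diff_right: "A \<odot> (B - B') = A \<odot> B - A \<odot> B'"
  using prod_add_right[of A "B - B'" B'] by (simp add: algebra_simps)

lemma prod_Nil: "(A \<odot> B) [] = A [] * B []"
  by (simp add: prod_op_def)

lemma prod_lmul_left: "lmul b A \<odot> B = lmul b (A \<odot> B)"
proof -
  have "prd xs (lmul b A) B = b * prd xs A B" for xs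
    by (induction xs arbitrary: A B) (simp_all add: distrib_left mult_gsum, simp_all add: lmul_def mult.assoc)
  then show ?thesis
    by (simp add: prod_op_def lmul_def fun_eq_iff)
qed

text \<open>An embedded element has zero values, so in each step only the second summand survives
  and every argument goes to \<open>B\<close> without a sign.\<close>

lemma emb_prod: "emb a \<odot> B = lmul a B"
proof -
  have "prd xs (emb a) B = a * B xs" for xs
  proof (induction xs arbitrary: B)
    case Nil
    show ?case by (simp add: emb_def)
  next
    case (Cons b xs)
    have "prd xs 0 B' = 0" for B'
      using prd_add(1)[of xs 0 0 B'] by simp
    then show ?case
      using Cons by (simp add: ap_apply gsum_def)
  qed
  then show ?thesis
    by (simp add: prod_op_def lmul_def fun_eq_iff)
qed

text \<open>Valid for arbitrary functions on lists. Additivity in \<open>a\<close>, and the value at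
  the unit for inhomogeneous factors, are read off from this form.\<close>

lemma ap_prod_gsum: "ap (A \<odot> B) a xs = gsum (\<lambda>f x. (ap A x \<odot> tw f B) xs) a + (A \<odot> ap B a) xs"
  by (simp add: prod_op_def ap_apply)

lemma ap_prod_add:
  assumes "A \<in> PD i d" "B \<in> PD j e"
  shows "ap (A \<odot> B) (a + b) = ap (A \<odot> B) a + ap (A \<odot> B) b"
  by (rule ext) (simp add: ap_prod_gsum PD_ap_add[OF assms(1)] PD_ap_add[OF assms(2)]
      prod_add_left prod_add_right gsum_add)

lemma ap_prod_scale:
  assumes "A \<in> PD i d" "B \<in> PD j e"
  shows "ap (A \<odot> B) (scale c a) = pscale scale c (ap (A \<odot> B) a)"
proof
  fix xs
  show "ap (A \<odot> B) (scale c a) xs = pscale scale c (ap (A \<odot> B) a) xs"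
    unfolding ap_prod_gsum
    by (subst gsum_scale)
      (simp_all add: ap_prod_gsum PD_ap_scale[OF assms(1)] PD_ap_scale[OF assms(2)]
        prod_scale_left prod_scale_right, simp_all add: ap_prod_gsum pscale_def scale_right_distrib)
qed

text \<open>For homogeneous \<open>a\<close> the sum over components collapses to one term, and on a
  homogeneous \<open>B\<close> the twist is the prescribed sign.\<close>

lemma ap_prod:
  assumes "A \<in> PD i d" "B \<in> PD j e" "e \<in> Zn n" "f \<in> Zn n" "a \<in> V f"
  shows "ap (A \<odot> B) a = sg (pr (f + \<alpha>) (shift \<alpha> j e) + int j) (ap A a \<odot> B) + A \<odot> ap B a"
proof
  fix xs
  show "ap (A \<odot> B) a xs = (sg (pr (f + \<alpha>) (shift \<alpha> j e) + int j) (ap A a \<odot> B) + A \<odot> ap B a) xs"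
    unfolding ap_prod_gsum
    by (subst gsum_homogeneous[OF assms(4,5)])
      (simp_all add: PD_ap_zero[OF assms(1)] tw_PD[OF assms(2,3)] prod_sg_right)
qed

text \<open>The factor \<open>b\<close> has to cross \<open>A\<close>, or a value of
  \<open>A\<close> at an argument of degree \<open>f\<close>. The shifted degree of that value
  differs from that of \<open>A\<close> by f - \<alpha>, while the twist contributes f + \<alpha>;
  together these do not change the parity.\<close>

lemma prod_lmul_right:
  assumes "A \<in> PD i d" "d \<in> Zn n" "g \<in> Zn n" "b \<in> V g"
  shows "A \<odot> lmul b B = sg (pr g (shift \<alpha> i d)) (lmul b (A \<odot> B))"
proof -
  have "prd xs A (lmul b B) = sg (pr g (shift \<alpha> i d)) (b * prd xs A B)" for xs
    using assms(1,2)
  proof (induction xs arbitrary: A i d B)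
    case Nil
    show ?case
    proof (cases i)
      case 0
      then obtain x where x: "x \<in> V d" "A = emb x"
        using Nil by auto
      then show ?thesis
        using mult_graded_comm[OF Nil(2) assms(3) x(1) assms(4)] 0
        by (simp add: lmul_def emb_def pairing_shift_right pairing_commute[of n d] mult_sg_left
            flip: mult.assoc)
    next
      case (Suc i')
      then show ?thesis
        using Nil by (simp add: PD_Suc_Nil)
    qed
  next
    case (Cons a xs)
    have "prd xs (ap A x) (tw f (lmul b B)) = sg (pr g (shift \<alpha> i d)) (b * prd xs (ap A x) (tw f B))"
      if x: "f \<in> Zn n" "x \<in> V f" for f x
    proof (cases i)
      case 0
      have "prd xs 0 B' = 0" for B'
        using prd_add(1)[of xs 0 0 B'] by simp
      then show ?thesis
        using 0 Cons by auto
    next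
      case (Suc i')
      have "prd xs (ap A x) (sg k C) = sg k (prd xs (ap A x) C)" for k C
        using prod_sg_right[of "ap A x" k C] by (simp add: prod_op_def fun_eq_iff)
      then have "prd xs (ap A x) (tw f (lmul b B)) =
          sg (pr (f + \<alpha>) g + pr g (shift \<alpha> (i - 1) (d + f))) (b * prd xs (ap A x) (tw f B))"
        using Cons.IH[OF PD_ap[OF Cons.prems x] Zn_add[OF Cons.prems(2) x(1)]]
        by (simp add: tw_lmul[OF assms(3,4)] del: plus_fun_apply)
      then show ?thesis
        by (simp, intro sg_cong)
          (auto simp: Suc pairing_simps pairing_commute algebra_simps)
    qed
    then have "gsum (\<lambda>f x. prd xs (ap A x) (tw f (lmul b B))) a =
        sg (pr g (shift \<alpha> i d)) (b * gsum (\<lambda>f x. prd xs (ap A x) (tw f B)) a)"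
      unfolding mult_gsum sg_gsum by (rule gsum_cong)
    then show ?case
      using Cons by (simp add: distrib_left sg_add)
  qed
  then show ?thesis
    by (simp add: prod_op_def lmul_def fun_eq_iff)
qed

text \<open>Induction on the total genus. The values are sums of products of smaller total genus;
  the Leibniz rule and antisymmetry of the product follow from those of the factors by comparing
  signs term by term.\<close>

lemma PD_prod:
  assumes "A \<in> PD i d" "B \<in> PD j e" "d \<in> Zn n" "e \<in> Zn n"
  shows "A \<odot> B \<in> PD (i + j) (d + e)"
  using assms
proof (induction "i + j" arbitrary: i j d e A B)
  case 0
  then obtain x y where "x \<in> V d" "y \<in> V e" "A = emb x" "B = emb y"
    by auto
  moreover have "emb x \<odot> emb y = emb (x * y)" for x y
    by (simp add: emb_prod) (simp add: lmul_def emb_def fun_eq_iff)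
  ultimately show ?case
    using 0 mult_component by (simp del: plus_fun_apply)
next
  case (Suc N)
  note AB = Suc.prems and [simp] = Suc.prems(3,4)
  \<comment> \<open>The integer form of \<open>N\<close> keeps truncated subtraction out of the sign
    exponents.\<close>
  have N: "int N = int i + int j - 1"
    using Suc.hyps(2) by simp
  note hom = ap_prod[OF AB(1,2,4)]
  have "A \<odot> B \<in> PD (Suc N) (d + e)"
    unfolding PD_Suc_iff
  proof (intro conjI allI ballI impI)
    \<comment> \<open>The total genus is positive, so at least one factor vanishes on the empty
      list.\<close>
    show "(A \<odot> B) [] = 0"
      using PD_Nil[OF AB(1)] PD_Nil[OF AB(2)] Suc.hyps(2) by (cases "i = 0") (auto simp: prod_Nil)
    show "ap (A \<odot> B) (a + b) = ap (A \<odot> B) a + ap (A \<odot> B) b" for a b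
      using AB(1,2) by (rule ap_prod_add)
    show "ap (A \<odot> B) (scale c a) = pscale scale c (ap (A \<odot> B) a)" for c a
      using AB(1,2) by (rule ap_prod_scale)
  next
    fix f a
    assume a: "f \<in> Zn n" "a \<in> V f"
    \<comment> \<open>A factor of genus 0 has zero values, so its summand is zero and the induction
      hypothesis is applied only to a factor whose genus really drops.\<close>
    have zero: "0 \<in> PD N (d + e + f)"
      using a by (intro PD_zero Zn_add) simp_all
    have "ap A a \<odot> B \<in> PD N (d + e + f)"
    proof (cases i)
      case 0
      then have "ap A a = 0"
        using AB by auto
      then show ?thesis
        using zero by (simp del: zero_fun_apply plus_fun_apply)
    next
      case (Suc i')
      then show ?thesis
        using Suc.hyps(1)[OF _ PD_ap[OF AB(1,3) a] AB(2) Zn_add[OF AB(3) a(1)] AB(4)] Suc.hyps(2)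
        by (simp add: add.assoc add.commute[of f])
    qed
    moreover have "A \<odot> ap B a \<in> PD N (d + e + f)"
    proof (cases j)
      case 0
      then have "ap B a = 0"
        using AB by auto
      then show ?thesis
        using zero by (simp del: zero_fun_apply plus_fun_apply)
    next
      case (Suc j')
      then show ?thesis
        using Suc.hyps(1)[OF _ AB(1) PD_ap[OF AB(2,4) a] AB(3) Zn_add[OF AB(4) a(1)]] Suc.hyps(2)
        by (simp add: add.assoc)
    qed
    ultimately show "ap (A \<odot> B) a \<in> PD N (d + e + f)"
      unfolding hom[OF a] using a by (intro PD_add PD_sg Zn_add) simp_all
  next
    fix f g a b
    assume fg: "f \<in> Zn n" "g \<in> Zn n" and ab: "a \<in> V f" "b \<in> V g"
    have mem: "f + g \<in> Zn n" "a * b \<in> V (f + g)"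
      using fg ab mult_component by auto
    let ?s = "\<lambda>f. pr (f + \<alpha>) (shift \<alpha> j e) + int j"
    have one: "1 \<in> V 0" "0 \<in> Zn n"
      by (simp_all add: one_component)
    \<comment> \<open>The product formula at \<open>a * b\<close>, then the Leibniz rule inside each
      factor; pulling the scalars out leaves six terms.\<close>
    have lhs: "ap (A \<odot> B) (a * b) =
        sg (?s (f + g) + pr g (shift \<alpha> (i + 1) (d + f))) (lmul b (ap A a \<odot> B))
      + sg (?s (f + g) + pr f (shift \<alpha> (i + 1) d)) (lmul a (ap A b \<odot> B))
      - sg (?s (f + g) + pr (f + g) (shift \<alpha> (i + 1) d)) (lmul (a * b) (ap A 1 \<odot> B))
      + (sg (pr g (shift \<alpha> (j + 1) (e + f)) + pr g (shift \<alpha> i d)) (lmul b (A \<odot> ap B a))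
      + sg (pr f (shift \<alpha> (j + 1) e) + pr f (shift \<alpha> i d)) (lmul a (A \<odot> ap B b))
      - sg (pr (f + g) (shift \<alpha> (j + 1) e) + pr (f + g) (shift \<alpha> i d)) (lmul (a * b) (A \<odot> ap B 1)))"
      unfolding hom[OF mem] PD_leibniz[OF AB(1) fg ab] PD_leibniz[OF AB(2) fg ab]
        prod_add_left prod_add_right prod_diff_left prod_diff_right prod_sg_left prod_sg_right
        prod_lmul_left prod_lmul_right[OF AB(1,3) fg(1) ab(1)] prod_lmul_right[OF AB(1,3) fg(2) ab(2)]
        prod_lmul_right[OF AB(1,3) mem] sg_add sg_diff sg_sg ..
    \<comment> \<open>The same six terms, now from evaluating the product at \<open>a\<close>,
      \<open>b\<close> and \<open>1\<close> separately; the unit has degree 0, hence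
      \<open>?s 0\<close>.\<close>
    have rhs: "sg (pr g (shift \<alpha> N (d + e + f))) (lmul b (ap (A \<odot> B) a))
        + sg (pr f (shift \<alpha> N (d + e))) (lmul a (ap (A \<odot> B) b))
        - sg (pr (f + g) (shift \<alpha> N (d + e))) (lmul (a * b) (ap (A \<odot> B) 1)) =
        sg (pr g (shift \<alpha> N (d + e + f)) + ?s f) (lmul b (ap A a \<odot> B))
      + sg (pr f (shift \<alpha> N (d + e)) + ?s g) (lmul a (ap A b \<odot> B))
      - sg (pr (f + g) (shift \<alpha> N (d + e)) + ?s 0) (lmul (a * b) (ap A 1 \<odot> B))
      + (sg (pr g (shift \<alpha> N (d + e + f))) (lmul b (A \<odot> ap B a))
      + sg (pr f (shift \<alpha> N (d + e))) (lmul a (A \<odot> ap B b))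
      - sg (pr (f + g) (shift \<alpha> N (d + e))) (lmul (a * b) (A \<odot> ap B 1)))"
      unfolding hom[OF fg(1) ab(1)] hom[OF fg(2) ab(2)] hom[OF one(2,1)] lmul_add lmul_sg sg_add sg_sg
      by (simp only: add_diff_eq diff_add_eq diff_diff_eq2 add_ac diff_diff_add)
    have cong: "k1 = l1 \<Longrightarrow> k2 = l2 \<Longrightarrow> k3 = l3 \<Longrightarrow> k4 = l4 \<Longrightarrow> k5 = l5 \<Longrightarrow> k6 = l6 \<Longrightarrow>
        k1 + k2 - k3 + (k4 + k5 - k6) = l1 + l2 - l3 + (l4 + l5 - l6)"
      for k1 k2 k3 k4 k5 k6 l1 l2 l3 l4 l5 l6 :: "'a oper"
      by simp
    show "ap (A \<odot> B) (a * b) = sg (pr g (shift \<alpha> N (d + e + f))) (lmul b (ap (A \<odot> B) a))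
        + sg (pr f (shift \<alpha> N (d + e))) (lmul a (ap (A \<odot> B) b))
        - sg (pr (f + g) (shift \<alpha> N (d + e))) (lmul (a * b) (ap (A \<odot> B) 1))"
      unfolding lhs rhs
      by (intro cong sg_cong; simp add: pairing_simps N pairing_commute algebra_simps)
  next
    fix f g a b
    assume "0 < N" and fg: "f \<in> Zn n" "g \<in> Zn n" and ab: "a \<in> V f" "b \<in> V g"
    let ?s = "\<lambda>f e j. pr (f + \<alpha>) (shift \<alpha> j e) + int j"
    let ?t = "pr (f + \<alpha>) (g + \<alpha>) + 1"
    \<comment> \<open>Replaces the genus \<open>j - 1\<close> of a value of \<open>B\<close> by
      \<open>j + 1\<close>, which has the same parity; in genus 0 the value itself is zero.\<close>
    have sg_swap: "sg (?s f e' (j - 1)) (X \<odot> ap B c) = sg (?s f e' (j + 1)) (X \<odot> ap B c)" for f e' X c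
    proof (cases j)
      case 0
      then show ?thesis
        using AB by auto
    next
      case (Suc j')
      then show ?thesis
        by (intro sg_cong) (auto simp: pairing_simps algebra_simps)
    qed
    have two: "ap (ap (A \<odot> B) a) b =
        sg (?s f e j + ?s g e j) (ap (ap A a) b \<odot> B) + sg (?s f e j) (ap A a \<odot> ap B b)
      + (sg (?s g (e + f) (j + 1)) (ap A b \<odot> ap B a) + A \<odot> ap (ap B a) b)"
      if fg: "f \<in> Zn n" "g \<in> Zn n" and ab: "a \<in> V f" "b \<in> V g" for f g a b
      unfolding hom[OF fg(1) ab(1)] ap_add_oper ap_sg_oper
        ap_prod[OF PD_ap[OF AB(1,3) fg(1) ab(1)] AB(2,4) fg(2) ab(2)]
        ap_prod[OF AB(1) PD_ap[OF AB(2,4) fg(1) ab(1)] Zn_add[OF AB(4) fg(1)] fg(2) ab(2)]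
        sg_swap sg_add sg_sg ..
    \<comment> \<open>Exchanging \<open>a\<close> and \<open>b\<close> exchanges the two mixed
      terms, hence the crossed matching; the outer terms are handled by antisymmetry of
      \<open>A\<close> and of \<open>B\<close>.\<close>
    have cong: "k1 = l1 \<Longrightarrow> k2 = l3 \<Longrightarrow> k3 = l2 \<Longrightarrow> k4 = l4 \<Longrightarrow>
        k1 + k2 + (k3 + k4) = l1 + l2 + (l3 + l4)" for k1 k2 k3 k4 l1 l2 l3 l4 :: "'a oper"
      by simp
    show "ap (ap (A \<odot> B) a) b = sg ?t (ap (ap (A \<odot> B) b) a)"
      unfolding two[OF fg ab] two[OF fg(2,1) ab(2,1)] PD_antisym[OF AB(1) fg ab] PD_antisym[OF AB(2) fg ab]
        sg_add sg_sg prod_sg_left prod_sg_right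
      by (intro cong sg_cong; simp add: pairing_simps pairing_commute algebra_simps)
  qed
  then show ?case
    unfolding Suc.hyps(2) .
qed

text \<open>The degrees \<open>d\<close> and \<open>d'\<close> are kept separate so that operators
  can be compared without first rearranging sums of degrees.\<close>

lemma PD_eqI:
  assumes "D \<in> PD (Suc i) d" "E \<in> PD (Suc i) d'"
    and "\<And>e a. e \<in> Zn n \<Longrightarrow> a \<in> V e \<Longrightarrow> ap D a = ap E a"
  shows "D = E"
  by (rule oper_homogeneous_eqI)
    (simp_all only: PD_Suc_Nil[OF assms(1)] PD_Suc_Nil[OF assms(2)]
      PD_ap_add[OF assms(1)] PD_ap_add[OF assms(2)] assms(3))

text \<open>Evaluation distributes over the three factors, and each of the three summands is either
  zero or an instance of associativity in smaller total genus.\<close>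

lemma prod_assoc:
  assumes "A \<in> PD i d" "B \<in> PD j e" "C \<in> PD k c" "d \<in> Zn n" "e \<in> Zn n" "c \<in> Zn n"
  shows "(A \<odot> B) \<odot> C = A \<odot> (B \<odot> C)"
  using assms
proof (induction "i + j + k" arbitrary: i j k d e c A B C)
  case 0
  then show ?case
    by (auto simp: emb_prod prod_lmul_left)
next
  case (Suc N)
  note ABC = Suc.prems
  note AB = PD_prod[OF ABC(1,2,4,5)] and BC = PD_prod[OF ABC(2,3,5,6)]
  show ?case
  proof (rule PD_eqI)
    show "(A \<odot> B) \<odot> C \<in> PD (Suc N) (d + e + c)"
      using PD_prod[OF AB ABC(3) Zn_add[OF ABC(4,5)] ABC(6)] unfolding Suc.hyps(2) .
    show "A \<odot> (B \<odot> C) \<in> PD (Suc N) (d + (e + c))"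
      using PD_prod[OF ABC(1) BC ABC(4) Zn_add[OF ABC(5,6)]] unfolding Suc.hyps(2) add.assoc .
  next
    fix f a
    assume a: "f \<in> Zn n" "a \<in> V f"
    have "(ap A a \<odot> B) \<odot> C = ap A a \<odot> (B \<odot> C)"
    proof (cases i)
      case 0
      then show ?thesis
        using ABC by auto
    next
      case (Suc i')
      then show ?thesis
        using Suc.hyps(1)[OF _ PD_ap[OF ABC(1,4) a] ABC(2,3) Zn_add[OF ABC(4) a(1)] ABC(5,6)] Suc.hyps(2)
        by simp
    qed
    moreover have "(A \<odot> ap B a) \<odot> C = A \<odot> (ap B a \<odot> C)"
    proof (cases j)
      case 0
      then show ?thesis
        using ABC by auto
    next
      case (Suc j')
      then show ?thesis
        using Suc.hyps(1)[OF _ ABC(1) PD_ap[OF ABC(2,5) a] ABC(3,4) Zn_add[OF ABC(5) a(1)] ABC(6)] Suc.hyps(2)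
        by simp
    qed
    moreover have "(A \<odot> B) \<odot> ap C a = A \<odot> (B \<odot> ap C a)"
    proof (cases k)
      case 0
      then show ?thesis
        using ABC by auto
    next
      case (Suc k')
      then show ?thesis
        using Suc.hyps(1)[OF _ ABC(1,2) PD_ap[OF ABC(3,6) a] ABC(4,5) Zn_add[OF ABC(6) a(1)]] Suc.hyps(2)
        by simp
    qed
    \<comment> \<open>Crossing \<open>C\<close> and then \<open>B\<close> costs the same sign as
      crossing their product, since total degrees add.\<close>
    moreover have "sg (pr (f + \<alpha>) (shift \<alpha> k c) + int k + (pr (f + \<alpha>) (shift \<alpha> j e) + int j)) X
        = sg (pr (f + \<alpha>) (shift \<alpha> (j + k) (e + c)) + int (j + k)) X" for X :: "'a oper"
      by (rule sg_cong) (simp add: pairing_simps algebra_simps)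
    ultimately show "ap ((A \<odot> B) \<odot> C) a = ap (A \<odot> (B \<odot> C)) a"
      unfolding ap_prod[OF AB ABC(3,6) a] ap_prod[OF ABC(1) BC Zn_add[OF ABC(5,6)] a]
        ap_prod[OF ABC(1,2,5) a] ap_prod[OF ABC(2,3,6) a]
      by (simp add: prod_add_left prod_add_right prod_sg_left prod_sg_right sg_add add.assoc
          del: plus_fun_apply)
  qed
qed

text \<open>Evaluation gives the same two summands on both sides, in exchanged positions and with
  the explicit sign on different ones; each pair agrees by commutativity in smaller total
  genus.\<close>

lemma prod_comm:
  assumes "A \<in> PD i d" "B \<in> PD j e" "d \<in> Zn n" "e \<in> Zn n"
  shows "A \<odot> B = sg (pr (shift \<alpha> i d) (shift \<alpha> j e) + int i * int j) (B \<odot> A)"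
  using assms
proof (induction "i + j" arbitrary: i j d e A B)
  case 0
  then obtain x y where "x \<in> V d" "y \<in> V e" "A = emb x" "B = emb y" "i = 0" "j = 0"
    by auto
  then show ?case
    using mult_graded_comm[OF 0(4,5)]
    by (simp add: emb_prod pairing_simps) (simp add: lmul_def emb_def fun_eq_iff)
next
  case (Suc N)
  note AB = Suc.prems
  let ?k = "\<lambda>i d j e. pr (shift \<alpha> i d) (shift \<alpha> j e) + int i * int j"
  show ?case
  proof (rule PD_eqI)
    show "A \<odot> B \<in> PD (Suc N) (d + e)"
      using PD_prod[OF AB] unfolding Suc.hyps(2) .
    show "sg (?k i d j e) (B \<odot> A) \<in> PD (Suc N) (e + d)"
      using PD_sg[OF Zn_add[OF AB(4,3)] PD_prod[OF AB(2,1,4,3)]]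
      unfolding Suc.hyps(2) add.commute[of j i] .
  next
    fix f a
    assume a: "f \<in> Zn n" "a \<in> V f"
    \<comment> \<open>Passing from \<open>A\<close> to \<open>ap A a\<close> changes the total
      degree by the parity (f + \<alpha>, 1). The sign in the product formula is the pairing of this
      parity with the total degree of \<open>B\<close>.\<close>
    have "sg (pr (f + \<alpha>) (shift \<alpha> j e) + int j) (ap A a \<odot> B) = sg (?k i d j e) (B \<odot> ap A a)"
    proof (cases i)
      case 0
      then show ?thesis
        using AB by auto
    next
      case (Suc i')
      then have *: "ap A a \<odot> B = sg (?k i' (d + f) j e) (B \<odot> ap A a)"
        using Suc.hyps(1)[OF _ PD_ap[OF AB(1,3) a] AB(2) Zn_add[OF AB(3) a(1)] AB(4)] Suc.hyps(2)
        by (simp del: plus_fun_apply)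
      show ?thesis
        unfolding * sg_sg by (rule sg_cong) (simp add: Suc pairing_simps pairing_commute algebra_simps)
    qed
    moreover have "A \<odot> ap B a = sg (?k i d j e + (pr (f + \<alpha>) (shift \<alpha> i d) + int i)) (ap B a \<odot> A)"
    proof (cases j)
      case 0
      then show ?thesis
        using AB by auto
    next
      case (Suc j')
      then have *: "A \<odot> ap B a = sg (?k i d j' (e + f)) (ap B a \<odot> A)"
        using Suc.hyps(1)[OF _ AB(1) PD_ap[OF AB(2,4) a] AB(3) Zn_add[OF AB(4) a(1)]] Suc.hyps(2)
        by (simp del: plus_fun_apply)
      show ?thesis
        unfolding * by (rule sg_cong)
          (simp add: Suc pairing_simps pairing_commute algebra_simps)
    qed
    ultimately show "ap (A \<odot> B) a = ap (sg (?k i d j e) (B \<odot> A)) a"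
      unfolding ap_sg_oper ap_prod[OF AB(1,2,4) a] ap_prod[OF AB(2,1,3) a] sg_add sg_sg
      by (simp only: add.commute)
  qed
qed

text \<open>By commutativity this is the left action up to sign. Since \<open>emb a\<close> has
  total degree (e, 0), the sign is the one that defines the right action.\<close>

lemma prod_emb:
  assumes "A \<in> PD i d" "d \<in> Zn n" "e \<in> Zn n" "a \<in> V e"
  shows "A \<odot> emb a = rmul n \<alpha> i d e A a"
proof -
  have "emb a \<in> PD 0 e" "shift \<alpha> 0 e = e"
    using assms by (simp_all add: shift_def)
  then show ?thesis
    using prod_comm[OF assms(1) \<open>emb a \<in> PD 0 e\<close> assms(2,3)]
    by (simp add: emb_prod rmul_def pairing_commute)
qed

section \<open>The grading of the algebra of operators\<close>

text \<open>\<open>proj_at xs d D\<close> is the value at \<open>xs\<close> of the degree \<open>d\<close> part of \<open>D\<close>.\<close>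

primrec proj_at :: "'a list \<Rightarrow> deg \<Rightarrow> 'a oper \<Rightarrow> 'a" where
  "proj_at [] d D = comp (D []) d"
| "proj_at (a # xs) d D = gsum (\<lambda>f x. proj_at xs (d + f) (ap D x)) a"

text \<open>The length of the list separates the genera and \<open>proj_at\<close> separates the
  degrees, so together they single out one component.\<close>

definition proj :: "nat \<Rightarrow> deg \<Rightarrow> 'a oper \<Rightarrow> 'a oper" where
  "proj i d D = (\<lambda>xs. if length xs = i then proj_at xs d D else 0)"

lemma proj_at_add: "proj_at xs d (D + E) = proj_at xs d D + proj_at xs d E"
  by (induction xs arbitrary: d D E) (simp_all add: comp_add gsum_plus)

lemma proj_add: "proj i d (D + E) = proj i d D + proj i d E"
  by (simp add: proj_def proj_at_add fun_eq_iff)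

text \<open>An operator of degree \<open>e\<close> raises the sum of the degrees of its arguments by
  \<open>e\<close>. The recursion in \<open>proj_at\<close> adds these degrees to \<open>d\<close>,
  so the component taken at the end is the full value or zero.\<close>

lemma proj_at_PD:
  "D \<in> PD j e \<Longrightarrow> d \<in> Zn n \<Longrightarrow> e \<in> Zn n \<Longrightarrow> proj_at xs d D = (if d = e then D xs else 0)"
proof (induction xs arbitrary: d e j D)
  case Nil
  then show ?case
    by (cases j) (auto simp: PD_Suc_Nil comp_homogeneous comp_zero emb_def)
next
  case (Cons a xs)
  have add: "proj_at xs d' (ap D (x + y)) = proj_at xs d' (ap D x) + proj_at xs d' (ap D y)" for d' x y
    by (simp add: PD_ap_add[OF Cons.prems(1)] proj_at_add)
  have "gsum (\<lambda>f x. proj_at xs (d + f) (ap D x)) a = (if d = e then ap D a xs else 0)"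
  proof (induction a rule: homogeneous_induct)
    case (1 f a)
    have zero: "proj_at xs (d + f) (ap D 0) = 0"
      using add[of "d + f" 0 0] by simp
    show ?case
      unfolding gsum_homogeneous[where F = "\<lambda>f x. proj_at xs (d + f) (ap D x)", OF 1 zero]
        Cons.IH[OF PD_ap[OF Cons.prems(1,3) 1] Zn_add[OF Cons.prems(2) 1(1)] Zn_add[OF Cons.prems(3) 1(1)]]
      by (simp del: plus_fun_apply)
  next
    case (2 a b)
    then show ?case
      unfolding gsum_add[where F = "\<lambda>f x. proj_at xs (d + f) (ap D x)", OF add]
        PD_ap_add[OF Cons.prems(1)] 2 by simp
  qed
  then show ?case
    by (simp add: ap_apply)
qed

lemma proj_PD:
  assumes "D \<in> PD j e" "d \<in> Zn n" "e \<in> Zn n"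
  shows "proj i d D = (if i = j \<and> d = e then D else 0)"
  using proj_at_PD[OF assms] PD_length[OF assms(1,3)] by (auto simp: proj_def fun_eq_iff)

text \<open>The unit is homogeneous of degree 0, so at most one term occurs. Vanishing at the unit
  is thereby inherited by products and by projections.\<close>

lemma gsum_one: "F 0 1 = 0 \<Longrightarrow> gsum F 1 = 0"
  using comp_homogeneous[OF Zn_zero one_component] by (auto simp: gsum_def intro!: sum.neutral)

lemma ap_proj_one: "ap D 1 = 0 \<Longrightarrow> ap (proj i d D) 1 = 0"
proof
  fix xs
  assume "ap D 1 = 0"
  moreover have "proj_at xs d 0 = 0" for d
    using proj_at_add[of xs d 0 0] by simp
  ultimately show "ap (proj i d D) 1 xs = 0 xs"
    by (simp add: ap_apply proj_def gsum_one)
qed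

section \<open>Total degrees and their components\<close>

abbreviation "pcomp \<equiv> polydiff_component n scale V \<alpha>"
abbreviation "tdeg \<equiv> total_deg n \<alpha>"

lemma tdeg_Zn: "d \<in> Zn n \<Longrightarrow> tdeg i d \<in> Zn (Suc n)"
  using \<alpha> by (auto simp: Zn_def total_deg_def shift_def)

lemma tdeg_genus: "tdeg i d n = int i"
  by (simp add: total_deg_def)

lemma tdeg_inj: "d \<in> Zn n \<Longrightarrow> e \<in> Zn n \<Longrightarrow> tdeg i d = tdeg j e \<longleftrightarrow> i = j \<and> d = e"
proof
  assume *: "tdeg i d = tdeg j e" and de: "d \<in> Zn n" "e \<in> Zn n"
  then have ij: "i = j"
    using tdeg_genus[of i d] tdeg_genus[of j e] by simp
  \<comment> \<open>From coordinate \<open>n\<close> on, \<open>d\<close> and \<open>e\<close>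
    vanish by membership in \<open>Zn n\<close>; this covers coordinate \<open>n\<close>, which the
    genus overwrites.\<close>
  have "d k = e k" for k
    using fun_cong[OF *, of k] de by (cases "k < n") (auto simp: ij total_deg_def shift_def Zn_def)
  then show "i = j \<and> d = e"
    using ij by auto
qed simp

lemma tdeg_add: "tdeg i d + tdeg j e = tdeg (i + j) (d + e)"
  by (auto simp: total_deg_def shift_def fun_eq_iff algebra_simps)

lemma pairing_tdeg: "pairing (Suc n) (tdeg i d) (tdeg j e) = pr (shift \<alpha> i d) (shift \<alpha> j e) + int i * int j"
  by (simp add: pairing_def total_deg_def)

lemma pcomp_tdeg: "d \<in> Zn n \<Longrightarrow> pcomp (tdeg i d) = PD i d"
proof -
  assume d: "d \<in> Zn n"
  then have iff: "d' \<in> Zn n \<and> tdeg i' d' = tdeg i d \<longleftrightarrow> i' = i \<and> d' = d" for i' d'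
    using tdeg_inj[of d' d i' i] by auto
  show ?thesis
    unfolding polydiff_component_def iff using PD_zero[OF d]
    by (simp add: insert_absorb del: zero_fun_apply)
qed

lemma pcomp_cases:
  obtains i d where "d \<in> Zn n" "\<delta> = tdeg i d" "pcomp \<delta> = PD i d"
  | "pcomp \<delta> = {0}" "\<not> (\<exists>i. \<exists>d\<in>Zn n. \<delta> = tdeg i d)"
proof (cases "\<exists>i. \<exists>d\<in>Zn n. \<delta> = tdeg i d")
  case True
  then show ?thesis
    using that(1) pcomp_tdeg by blast
next
  case False
  then have "pcomp \<delta> = {0}"
    by (auto simp: polydiff_component_def)
  then show ?thesis
    using that(2) False by blast
qed

abbreviation "PDall \<equiv> polydiff n scale V \<alpha>"

text \<open>Replaces the span in two stages, first in each genus and then over all genera, by one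
  span over total degrees, the form required by \<open>graded_space_spanI\<close>.\<close>

lemma polydiff_eq: "PDall = ops.span (\<Union>\<delta>\<in>Zn (Suc n). pcomp \<delta>)"
proof
  have "PD i d \<subseteq> (\<Union>\<delta>\<in>Zn (Suc n). pcomp \<delta>)" if "d \<in> Zn n" for i d
    using pcomp_tdeg[OF that] tdeg_Zn[OF that] by blast
  then have "(\<Union>d\<in>Zn n. PD i d) \<subseteq> (\<Union>\<delta>\<in>Zn (Suc n). pcomp \<delta>)" for i
    by blast
  then have "genus_space n scale V \<alpha> i \<subseteq> ops.span (\<Union>\<delta>\<in>Zn (Suc n). pcomp \<delta>)" for i
    unfolding genus_space_def by (rule ops.span_mono)
  then show "PDall \<subseteq> ops.span (\<Union>\<delta>\<in>Zn (Suc n). pcomp \<delta>)"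
    unfolding polydiff_def by (intro ops.span_minimal) auto
next
  have "pcomp \<delta> \<subseteq> PDall" for \<delta>
  proof (cases \<delta> rule: pcomp_cases)
    case (1 i d)
    then have "PD i d \<subseteq> genus_space n scale V \<alpha> i"
      by (auto simp: genus_space_def intro: ops.span_base)
    also have "\<dots> \<subseteq> PDall"
      by (auto simp: polydiff_def intro: ops.span_base)
    finally show ?thesis
      using 1 by simp
  next
    case 2
    then show ?thesis
      using ops.span_zero by (simp add: polydiff_def del: zero_fun_apply)
  qed
  then show "ops.span (\<Union>\<delta>\<in>Zn (Suc n). pcomp \<delta>) \<subseteq> PDall"
    unfolding polydiff_def by (intro ops.span_minimal ops.subspace_span) auto
qed

lemma genus_space_induct [consumes 1]:
  assumes "D \<in> genus_space n scale V \<alpha> i"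
    and "\<And>d D. d \<in> Zn n \<Longrightarrow> D \<in> PD i d \<Longrightarrow> P D"
    and "\<And>D E. P D \<Longrightarrow> P E \<Longrightarrow> P (D + E)"
  shows "P D"
  using assms(1) unfolding genus_space_def
proof (induction rule: ops.span_induct_alt)
  case base
  show ?case
    using PD_zero[of 0] assms(2)[of 0] by (simp del: zero_fun_apply)
next
  case (step c x y)
  then obtain d where "d \<in> Zn n" "x \<in> PD i d"
    by auto
  then show ?case
    using step assms(2,3) PD_pscale by blast
qed

lemma PD_genus_space: "d \<in> Zn n \<Longrightarrow> D \<in> PD i d \<Longrightarrow> D \<in> genus_space n scale V \<alpha> i"
  unfolding genus_space_def by (rule ops.span_base) blast

lemma genus_space_polydiff: "D \<in> genus_space n scale V \<alpha> i \<Longrightarrow> D \<in> PDall"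
  unfolding polydiff_def by (rule ops.span_base) blast

lemma PD_polydiff: "d \<in> Zn n \<Longrightarrow> D \<in> PD i d \<Longrightarrow> D \<in> PDall"
  using PD_genus_space genus_space_polydiff by blast

lemma polydiff_subspace: "ops.subspace PDall"
  unfolding polydiff_def by (rule ops.subspace_span)

lemma polydiff_induct [consumes 1]:
  assumes "D \<in> PDall"
    and "\<And>i d D. d \<in> Zn n \<Longrightarrow> D \<in> PD i d \<Longrightarrow> P D"
    and "\<And>D E. D \<in> PDall \<Longrightarrow> E \<in> PDall \<Longrightarrow> P D \<Longrightarrow> P E \<Longrightarrow> P (D + E)"
  shows "P D"
proof -
  \<comment> \<open>Membership is carried along because the addition case of the rule offers it for
    both summands.\<close>
  have "P D \<and> D \<in> PDall"
    using assms(1) unfolding polydiff_eq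
  proof (induction rule: ops.span_induct_alt)
    case base
    show ?case
      using PD_zero[of 0 0] assms(2)[of 0 0 0] PD_polydiff[of 0 0 0]
      by (simp del: zero_fun_apply pdo.simps add: polydiff_eq)
  next
    case (step c x y)
    then obtain \<delta> where \<delta>: "x \<in> pcomp \<delta>"
      by auto
    \<comment> \<open>If the total degree is not attained then \<open>x = 0\<close>, which is placed
      in genus 0 and degree 0.\<close>
    have "\<exists>i. \<exists>d\<in>Zn n. x \<in> PD i d"
    proof (cases \<delta> rule: pcomp_cases)
      case 2
      then have "x = 0"
        using \<delta> by simp
      then show ?thesis
        by (intro exI[of _ 0] bexI[of _ 0]) (simp_all only: PD_zero Zn_zero)
    qed (use \<delta> in blast)
    then obtain i d where "d \<in> Zn n" "pscale scale c x \<in> PD i d"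
      using PD_pscale by blast
    then show ?case
      using step.IH assms(2,3) PD_polydiff ops.subspace_add[OF polydiff_subspace]
      unfolding polydiff_eq by blast
  qed
  then show ?thesis ..
qed

text \<open>Decodes a total degree: the last coordinate is the genus, and the remaining degree is
  then unique by \<open>tdeg_inj\<close>. Degrees that are not attained project to zero.\<close>

definition tproj :: "deg \<Rightarrow> 'a oper \<Rightarrow> 'a oper" where
  "tproj \<delta> D = (if \<exists>i. \<exists>d\<in>Zn n. \<delta> = tdeg i d
     then proj (nat (\<delta> n)) (THE d. d \<in> Zn n \<and> \<delta> = tdeg (nat (\<delta> n)) d) D else 0)"

lemma tproj_tdeg: "d \<in> Zn n \<Longrightarrow> tproj (tdeg i d) D = proj i d D"
proof -
  assume d: "d \<in> Zn n"
  then have "(THE d'. d' \<in> Zn n \<and> tdeg i d = tdeg i d') = d"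
    by (intro the_equality) (auto simp: tdeg_inj)
  then show ?thesis
    using d by (auto simp: tproj_def tdeg_genus)
qed

lemma pcomp_subspace: "ops.subspace (pcomp \<delta>)"
proof (cases \<delta> rule: pcomp_cases)
  case (1 i d)
  then show ?thesis
    using PD_zero PD_add PD_pscale by (simp add: ops.subspace_def del: zero_fun_apply plus_fun_apply)
qed (simp add: ops.subspace_single_0 del: zero_fun_apply)

lemma tproj_add: "tproj \<delta> (D + E) = tproj \<delta> D + tproj \<delta> E"
  by (simp add: tproj_def proj_add)

lemma tproj_same:
  assumes "D \<in> pcomp \<delta>"
  shows "tproj \<delta> D = D"
  using assms by (cases \<delta> rule: pcomp_cases) (auto simp: tproj_tdeg proj_PD, auto simp: tproj_def)

lemma tproj_other:
  assumes "\<delta> \<noteq> \<epsilon>" "D \<in> pcomp \<epsilon>"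
  shows "tproj \<delta> D = 0"
proof (cases \<epsilon> rule: pcomp_cases)
  case \<epsilon>: (1 j e)
  show ?thesis
  proof (cases \<delta> rule: pcomp_cases)
    case (1 i d)
    then show ?thesis
      using \<epsilon> assms by (auto simp: tproj_tdeg proj_PD)
  qed (auto simp: tproj_def)
next
  case 2
  then show ?thesis
    using assms tproj_add[of \<delta> 0 0] by simp
qed

lemma operators_graded_space: "graded_space (pscale scale) (Suc n) PDall pcomp"
  unfolding polydiff_eq
  by (rule ops.graded_space_spanI(1)[where P = tproj])
    (rule pcomp_subspace tproj_add tproj_same tproj_other; assumption)+

lemma tproj_sum:
  assumes "finite {\<delta>. f \<delta> \<noteq> 0}" "\<forall>\<delta>\<in>Zn (Suc n). f \<delta> \<in> pcomp \<delta>"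
    "\<forall>\<delta>. \<delta> \<notin> Zn (Suc n) \<longrightarrow> f \<delta> = 0" "\<delta> \<in> Zn (Suc n)"
  shows "tproj \<delta> (\<Sum>\<delta> | f \<delta> \<noteq> 0. f \<delta>) = f \<delta>"
  by (rule ops.graded_space_spanI(2)[where P = tproj, OF _ _ _ _ assms])
    (rule pcomp_subspace tproj_add tproj_same tproj_other; assumption)+

section \<open>The algebra structure on inhomogeneous operators\<close>

lemma prod_polydiff:
  assumes "A \<in> PDall" "B \<in> PDall"
  shows "A \<odot> B \<in> PDall"
  using assms(1)
proof (induction A rule: polydiff_induct)
  case (1 i d A)
  show ?case
    using assms(2)
  proof (induction B rule: polydiff_induct)
    case (1 j e B)
    then show ?case
      using PD_prod PD_polydiff Zn_add \<open>A \<in> PD i d\<close> \<open>d \<in> Zn n\<close> by blast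
  next
    case (2 B B')
    then show ?case
      unfolding prod_add_right by (intro ops.subspace_add polydiff_subspace)
  qed
next
  case (2 A A')
  then show ?case
    unfolding prod_add_left by (intro ops.subspace_add polydiff_subspace)
qed

lemma prod_polydiff_assoc:
  assumes "A \<in> PDall" "B \<in> PDall" "C \<in> PDall"
  shows "(A \<odot> B) \<odot> C = A \<odot> (B \<odot> C)"
  using assms(1)
proof (induction A rule: polydiff_induct)
  case A: (1 i d A)
  show ?case
    using assms(2)
  proof (induction B rule: polydiff_induct)
    case B: (1 j e B)
    show ?case
      using assms(3)
    proof (induction C rule: polydiff_induct)
      case (1 k c C)
      then show ?case
        using A B prod_assoc by blast
    qed (simp only: prod_add_right)
  qed (simp only: prod_add_right prod_add_left)
qed (simp only: prod_add_left)

lemma emb_one_prod: "emb 1 \<odot> A = A"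
  by (simp add: emb_prod lmul_def)

lemma emb_one_PD: "emb 1 \<in> PD 0 0"
  by (simp add: one_component)

lemma prod_emb_one:
  assumes "A \<in> PDall"
  shows "A \<odot> emb 1 = A"
  using assms
proof (induction A rule: polydiff_induct)
  case (1 i d A)
  then show ?case
    using prod_emb[OF 1(2,1) Zn_zero one_component] by (simp add: rmul_def lmul_def)
qed (simp only: prod_add_left)

lemma operators_algebra: "graded_comm_algebra (pscale scale) (Suc n) PDall pcomp (\<odot>) (emb 1)"
proof (intro graded_comm_algebra.intro graded_comm_algebra_axioms.intro)
  show "graded_space (pscale scale) (Suc n) PDall pcomp"
    by (rule operators_graded_space)
  have "tdeg 0 0 = 0"
    by (auto simp: total_deg_def shift_def fun_eq_iff)
  then show "emb 1 \<in> pcomp 0"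
    using pcomp_tdeg[of 0 0] emb_one_PD by (simp only: Zn_zero)
  fix \<delta> \<epsilon> A B
  assume *: "A \<in> pcomp \<delta>" "B \<in> pcomp \<epsilon>"
  have zero: "0 \<in> pcomp (\<delta> + \<epsilon>)"
    using ops.subspace_0[OF pcomp_subspace] .
  show "A \<odot> B \<in> pcomp (\<delta> + \<epsilon>)"
  proof (cases \<delta> rule: pcomp_cases)
    case \<delta>: (1 i d)
    show ?thesis
    proof (cases \<epsilon> rule: pcomp_cases)
      case \<epsilon>: (1 j e)
      then show ?thesis
        using PD_prod[OF _ _ \<delta>(1) \<epsilon>(1)] * \<delta> pcomp_tdeg[OF Zn_add[OF \<delta>(1) \<epsilon>(1)]]
        by (simp only: tdeg_add)
    next
      case 2
      then have "A \<odot> B = 0"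
        using * by simp
      then show ?thesis
        using zero by (simp only:)
    qed
  next
    case 2
    then have "A \<odot> B = 0"
      using * by simp
    then show ?thesis
      using zero by (simp only:)
  qed
  show "A \<odot> B = sg (pairing (Suc n) \<delta> \<epsilon>) (B \<odot> A)"
  proof (cases \<delta> rule: pcomp_cases)
    case \<delta>: (1 i d)
    show ?thesis
    proof (cases \<epsilon> rule: pcomp_cases)
      case \<epsilon>: (1 j e)
      have "A \<in> PD i d" "B \<in> PD j e"
        using * \<delta> \<epsilon> by blast+
      then show ?thesis
        using prod_comm \<delta>(1) \<epsilon>(1) unfolding \<delta>(2) \<epsilon>(2) pairing_tdeg by blast
    qed (use * in auto)
  qed (use * in auto)
qed (simp_all only: prod_polydiff prod_polydiff_assoc prod_add_left prod_add_right prod_scale_left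
    prod_scale_right emb_one_prod prod_emb_one)

lemma polydiff_product_prod: "polydiff_product n scale V \<alpha> (\<odot>)"
  unfolding polydiff_product_def
  by (intro conjI ballI allI prod_add_left prod_add_right prod_scale_left prod_scale_right PD_prod
      emb_prod prod_emb ap_prod)

text \<open>Products with a factor of genus 0 are fixed by the module structures; in the remaining
  cases the formula fixes all values by induction on the total genus. Bilinearity extends the
  equality to inhomogeneous operators.\<close>

lemma polydiff_product_unique:
  assumes m: "polydiff_product n scale V \<alpha> m" and "A \<in> PDall" "B \<in> PDall"
  shows "m A B = A \<odot> B"
proof -
  have m_add: "m (A + A') B = m A B + m A' B" "m B (A + A') = m B A + m B A'"
    if "A \<in> PDall" "A' \<in> PDall" "B \<in> PDall" for A A' B
    using m[unfolded polydiff_product_def, THEN conjunct1] that by blast+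
  note m = m[unfolded polydiff_product_def, THEN conjunct2]
  have m_PD: "m A B \<in> PD (i + j) (d + e)"
    if "A \<in> PD i d" "B \<in> PD j e" "d \<in> Zn n" "e \<in> Zn n" for i j d e A B
    using m[THEN conjunct1] that by blast
  have m_emb: "m (emb a) A = lmul a A" "m A (emb a) = rmul n \<alpha> i d e A a"
    if "A \<in> PD i d" "d \<in> Zn n" "e \<in> Zn n" "a \<in> V e" for i d e a A
    using m[THEN conjunct2, THEN conjunct1] that by blast+
  have m_ap: "ap (m A B) a = sg (pr (f + \<alpha>) (shift \<alpha> j e) + int j) (m (ap A a) B) + m A (ap B a)"
    if "A \<in> PD i d" "B \<in> PD j e" "d \<in> Zn n" "e \<in> Zn n" "f \<in> Zn n" "a \<in> V f" for i j d e f a A B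
    using m[THEN conjunct2, THEN conjunct2] that by blast
  have hom: "m A B = A \<odot> B"
    if "A \<in> PD i d" "B \<in> PD j e" "d \<in> Zn n" "e \<in> Zn n" for i j d e A B
    using that
  proof (induction "i + j" arbitrary: i j d e A B rule: less_induct)
    case less
    note AB = less.prems
    show ?case
    proof (cases "i = 0 \<or> j = 0")
      case True
      then show ?thesis
      proof
        assume "i = 0"
        then obtain a where "a \<in> V d" "A = emb a"
          using AB by auto
        then show ?thesis
          using m_emb(1)[OF AB(2,4,3)] emb_prod by metis
      next
        assume "j = 0"
        then obtain b where "b \<in> V e" "B = emb b"
          using AB by auto
        then show ?thesis
          using m_emb(2)[OF AB(1,3,4)] prod_emb[OF AB(1,3,4)] by metis
      qed
    next
      case False
      then obtain N where N: "i + j = Suc N"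
        by (cases "i + j") auto
      show ?thesis
      proof (rule PD_eqI)
        show "m A B \<in> PD (Suc N) (d + e)" "A \<odot> B \<in> PD (Suc N) (d + e)"
          using m_PD[OF AB] PD_prod[OF AB] unfolding N .
        fix f a
        assume a: "f \<in> Zn n" "a \<in> V f"
        \<comment> \<open>Both genera are positive here, so \<open>i - 1\<close> and
          \<open>j - 1\<close> strictly decrease the total genus.\<close>
        have "m (ap A a) B = ap A a \<odot> B"
          using False by (intro less.hyps[OF _ PD_ap[OF AB(1,3) a] AB(2) Zn_add[OF AB(3) a(1)] AB(4)]) simp
        moreover have "m A (ap B a) = A \<odot> ap B a"
          using False by (intro less.hyps[OF _ AB(1) PD_ap[OF AB(2,4) a] AB(3) Zn_add[OF AB(4) a(1)]]) simp
        ultimately show "ap (m A B) a = ap (A \<odot> B) a"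
          unfolding m_ap[OF AB a] ap_prod[OF AB(1,2,4) a] by (simp only:)
      qed
    qed
  qed
  show ?thesis
    using assms(2)
  proof (induction A rule: polydiff_induct)
    case A: (1 i d A)
    show ?case
      using assms(3)
    proof (induction B rule: polydiff_induct)
      case (1 j e B)
      then show ?case
        using hom A by blast
    next
      case (2 B B')
      then show ?case
        using m_add(2)[OF 2(1,2) PD_polydiff[OF A]] by (simp only: prod_add_right)
    qed
  next
    case (2 A A')
    then show ?case
      using m_add(1)[OF 2(1,2) assms(3)] by (simp only: prod_add_left)
  qed
qed

section \<open>Polyderivations\<close>

abbreviation "PGall \<equiv> polyder n scale V \<alpha>"
abbreviation "PG \<equiv> polyder_genus n scale V \<alpha>"
abbreviation "GS \<equiv> genus_space n scale V \<alpha>"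

text \<open>Values in genus 0 are zero, so the condition at the unit can be stated without
  distinguishing genera.\<close>

lemma polyder_genus_iff: "D \<in> PG i \<longleftrightarrow> D \<in> GS i \<and> ap D 1 = 0"
proof -
  have "ap D 1 = 0" if "D \<in> GS 0"
    using that
  proof (induction D rule: genus_space_induct)
    case (2 D E)
    then show ?case
      by (simp only: ap_add_oper add_0)
  qed auto
  then show ?thesis
    by (auto simp: polyder_genus_def)
qed

lemma genus_space_prod:
  assumes "A \<in> GS i" "B \<in> GS j"
  shows "A \<odot> B \<in> GS (i + j)"
  using assms(1)
proof (induction A rule: genus_space_induct)
  case A: (1 d A)
  show ?case
    using assms(2)
  proof (induction B rule: genus_space_induct)
    case (1 e B)
    then show ?case
      using PD_prod PD_genus_space A Zn_add by blast
  next
    case (2 B B')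
    then show ?case
      unfolding prod_add_right genus_space_def by (rule ops.span_add)
  qed
next
  case (2 A A')
  then show ?case
    unfolding prod_add_left genus_space_def by (rule ops.span_add)
qed

text \<open>Evaluating the product at the unit involves the factors only through
  \<open>ap A 1\<close> and \<open>ap B 1\<close>, both of which are zero.\<close>

lemma polyder_genus_prod:
  assumes "A \<in> PG i" "B \<in> PG j"
  shows "A \<odot> B \<in> PG (i + j)"
proof -
  have "ap (A \<odot> B) 1 = 0"
  proof
    fix xs
    show "ap (A \<odot> B) 1 xs = 0 xs"
      using assms unfolding polyder_genus_iff ap_prod_gsum
      by (simp add: gsum_one)
  qed
  then show ?thesis
    using assms genus_space_prod by (auto simp: polyder_genus_iff)
qed

lemma polyder_subspace: "ops.subspace PGall"
  unfolding polyder_def by (rule ops.subspace_span)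

lemma polyder_genus_polyder: "D \<in> PG i \<Longrightarrow> D \<in> PGall"
  unfolding polyder_def by (rule ops.span_base) blast

lemma polyder_polydiff: "PGall \<subseteq> PDall"
  unfolding polyder_def
  using genus_space_polydiff polydiff_subspace by (intro ops.span_minimal) (auto simp: polyder_genus_iff)

lemma polyder_induct [consumes 1]:
  assumes "D \<in> PGall"
    and "\<And>i D. D \<in> PG i \<Longrightarrow> P D"
    and "\<And>D E. P D \<Longrightarrow> P E \<Longrightarrow> P (D + E)"
  shows "P D"
  using assms(1) unfolding polyder_def
proof (induction rule: ops.span_induct_alt)
  case base
  have "0 \<in> PG 0"
    unfolding polyder_genus_iff genus_space_def using ops.span_zero by (simp del: zero_fun_apply)
  then show ?case
    using assms(2) by blast
next
  case (step c x y)
  then obtain i where "x \<in> PG i"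
    by auto
  then have "pscale scale c x \<in> PG i"
    unfolding polyder_genus_iff genus_space_def by (simp add: ops.span_scale del: zero_fun_apply)
  then show ?case
    using step assms(2,3) by blast
qed

lemma polyder_prod:
  assumes "A \<in> PGall" "B \<in> PGall"
  shows "A \<odot> B \<in> PGall"
  using assms(1)
proof (induction A rule: polyder_induct)
  case A: (1 i A)
  show ?case
    using assms(2)
  proof (induction B rule: polyder_induct)
    case (1 j B)
    then show ?case
      using polyder_genus_prod polyder_genus_polyder A by blast
  next
    case (2 B B')
    then show ?case
      unfolding prod_add_right by (intro ops.subspace_add polyder_subspace)
  qed
next
  case (2 A A')
  then show ?case
    unfolding prod_add_left by (intro ops.subspace_add polyder_subspace)
qed

text \<open>The homogeneous components of \<open>D\<close> are its projections, and projections
  preserve vanishing at the unit. Hence the components are again polyderivations.\<close>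

lemma polyder_genus_graded:
  assumes "D \<in> PG i"
  shows "D \<in> ops.span (\<Union>\<delta>\<in>Zn (Suc n). PGall \<inter> pcomp \<delta>)"
proof -
  interpret graded_comm_algebra "pscale scale" "Suc n" PDall pcomp "(\<odot>)" "emb 1"
    by (rule operators_algebra)
  have D: "ap D 1 = 0" "D \<in> PDall"
    using assms genus_space_polydiff by (auto simp: polyder_genus_iff)
  obtain f where f: "finite {\<delta>. f \<delta> \<noteq> 0}" "\<forall>\<delta>\<in>Zn (Suc n). f \<delta> \<in> pcomp \<delta>"
    "\<forall>\<delta>. \<delta> \<notin> Zn (Suc n) \<longrightarrow> f \<delta> = 0" "D = (\<Sum>\<delta> | f \<delta> \<noteq> 0. f \<delta>)"
    using direct_sum[OF D(2)] by blast
  have "f \<delta> \<in> PGall" if \<delta>: "\<delta> \<in> Zn (Suc n)" for \<delta>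
  proof (cases \<delta> rule: pcomp_cases)
    case (1 j d)
    then have "f \<delta> = proj j d D"
      using tproj_sum[OF f(1-3) \<delta>] f(4) tproj_tdeg by metis
    then have "ap (f \<delta>) 1 = 0"
      using ap_proj_one[OF D(1)] by (simp only:)
    moreover have "f \<delta> \<in> GS j"
      using 1 f(2) \<delta> PD_genus_space by blast
    ultimately show ?thesis
      using polyder_genus_polyder polyder_genus_iff by blast
  next
    case 2
    then have "f \<delta> = 0"
      using f(2) \<delta> by auto
    then show ?thesis
      using ops.subspace_0[OF polyder_subspace] by (simp only:)
  qed
  then have "f \<delta> \<in> ops.span (\<Union>\<delta>\<in>Zn (Suc n). PGall \<inter> pcomp \<delta>)" if "f \<delta> \<noteq> 0" for \<delta>
    using f(2,3) that by (intro ops.span_base) blast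
  then show ?thesis
    unfolding f(4) by (intro ops.span_sum) blast
qed

lemma polyder_subalgebra:
  "graded_subalgebra (pscale scale) (Suc n) PDall pcomp (\<odot>) (emb 1) PGall"
proof (intro graded_subalgebra.intro graded_subalgebra_axioms.intro)
  show "graded_comm_algebra (pscale scale) (Suc n) PDall pcomp (\<odot>) (emb 1)"
    by (rule operators_algebra)
  have "emb 1 \<in> PG 0"
    using PD_genus_space[OF Zn_zero emb_one_PD] by (simp add: polyder_genus_iff)
  then show "emb 1 \<in> PGall"
    by (rule polyder_genus_polyder)
  show "PGall = ops.span (\<Union>\<delta>\<in>Zn (Suc n). PGall \<inter> pcomp \<delta>)"
  proof
    show "PGall \<subseteq> ops.span (\<Union>\<delta>\<in>Zn (Suc n). PGall \<inter> pcomp \<delta>)"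
    proof
      fix D
      assume "D \<in> PGall"
      then show "D \<in> ops.span (\<Union>\<delta>\<in>Zn (Suc n). PGall \<inter> pcomp \<delta>)"
        by (induction D rule: polyder_induct) (rule polyder_genus_graded ops.span_add; assumption)+
    qed
  qed (intro ops.span_minimal polyder_subspace; blast)
qed (simp_all only: polyder_subspace polyder_polydiff polyder_prod)

end

theorem theorem9:
  fixes n :: nat
    and scale :: "'k::field_char_0 \<Rightarrow> 'a::{ring,monoid_mult} \<Rightarrow> 'a"
    and V :: "deg \<Rightarrow> 'a set"
    and \<alpha> :: deg
  assumes "graded_comm_algebra scale n UNIV V (*) 1"
    and "\<alpha> \<in> Zn n"
  shows "\<exists>m. polydiff_product n scale V \<alpha> m
    \<and> (\<forall>m'. polydiff_product n scale V \<alpha> m' \<longrightarrow>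
         (\<forall>A\<in>polydiff n scale V \<alpha>. \<forall>B\<in>polydiff n scale V \<alpha>. m' A B = m A B))
    \<and> graded_comm_algebra (pscale scale) (Suc n) (polydiff n scale V \<alpha>)
         (polydiff_component n scale V \<alpha>) m (emb 1)
    \<and> graded_subalgebra (pscale scale) (Suc n) (polydiff n scale V \<alpha>)
         (polydiff_component n scale V \<alpha>) m (emb 1) (polyder n scale V \<alpha>)"
proof -
  interpret polydiff_algebra scale n V \<alpha>
    using assms by (intro polydiff_algebra.intro polydiff_algebra_axioms.intro)
  show ?thesis
    using polydiff_product_prod polydiff_product_unique operators_algebra polyder_subalgebra by blast
qed

end
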